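(* Let $A$ be a nonsingular real $n\times n$ matrix and let $K:\mathbb{R}^n\to\mathbb{R}$ satisfy the following conditions. (i) $K\in L_2(\mathbb{R}^n)\cap L_1(\mathbb{R}^n)\cap C(\mathbb{R}^n)$. (ii) For some $C>0$ and $\delta>0$, $\max\{|K(x)|,|\mathbf{F}(K)(x)|\}\le C(1+|x|)^{-n-\delta}$ for all $x\in\mathbb{R}^n$. (iii) $\sum_{m\in\mathbb{Z}^n}\mathbf{F}(K)\left(z+2\pi (A^{-1})^{T}m\right)\neq 0$ for all $z\in 2\pi (A^{-1})^{T}Q$, where $Q:=\{x\in\mathbb{R}^n: 0\le x_k\le 1,\ 1\le k\le n\}$. (iv) The function $\Upsilon(z):=\left(\sum_{m\in\mathbb{Z}^n}\mathbf{F}(K)\left(z+2\pi (A^{-1})^{T}m\right)\right)^{-1}$ can be represented by its Fourier series, i.e. $\Upsilon(z)=\sum_{s\in\mathbb{Z}^n}\alpha_s\exp(-i\langle As,z\rangle)$ for any $z\in\mathbb{R}^n$. Then the fundamental $sk$-spline $\widetilde{sk}\in SK(\Omega_A)$ is given by $$\widetilde{sk}(x)=\mathbf{F}^{-1}\left(\frac{\mathbf{F}(K)(\cdot)}{\sum_{m\in\mathbb{Z}^n}K(-A^{T}m)\exp\left(i\langle Am,\cdot\rangle\right)}\right)(x).$$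
   Context: $\langle x,y\rangle=\sum_{k=1}^n x_ky_k$ is the usual scalar product on $\mathbb{R}^n$ and $|x|=\langle x,x\rangle^{1/2}$; $A^T$ denotes the transpose of $A$. The Fourier transform of $f\in L_1(\mathbb{R}^n)$ is $\mathbf{F}f(y)=\int_{\mathbb{R}^n}\exp(-i\langle x,y\rangle)f(x)\,dx$, with formal inverse $(\mathbf{F}^{-1}f)(x)=\frac{1}{(2\pi)^n}\int_{\mathbb{R}^n}\exp(i\langle x,y\rangle)f(y)\,dy$ (extended to $L_2(\mathbb{R}^n)$ by Plancherel's theorem). For a nonsingular $n\times n$ matrix $A$, $\Omega_A=\{x_m:=Am : m\in\mathbb{Z}^n\}$. For the fixed continuous kernel $K$, $SK(\Omega_A)$ is the space of $sk$-splines on $\Omega_A$, i.e. of functions in $L_2(\mathbb{R}^n)$ representable in the form $sk(x)=\sum_{m\in\mathbb{Z}^n}c_mK(x-x_m)$ with $c_m\in\mathbb{R}$. A fundamental (cardinal) $sk$-spline is a function $\widetilde{sk}\in SK(\Omega_A)$ such that $\widetilde{sk}(x_s)=1$ for $s=0$ and $\widetilde{sk}(x_s)=0$ for $s\in\mathbb{Z}^n$, $s\neq 0$.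
   Formalization: In the denominator K(-A^T m) is corrected to K(-Am); the printed formula fails for n=2, A=[[1,1],[0,1]], K=exp(-|x|^2/2). The series of an sk-spline is taken to converge unconditionally, both at every point and in L_2. *)

theory Defs
  imports "HOL-Analysis.Analysis"
begin

definition real_vec :: "int ^ 'n \<Rightarrow> real ^ 'n" where
  "real_vec m = (\<chi> k. real_of_int (m $ k))"

definition fourier :: "(real ^ 'n \<Rightarrow> complex) \<Rightarrow> real ^ 'n \<Rightarrow> complex" where
  "fourier f y = (LINT x|lborel. exp (- \<i> * complex_of_real (x \<bullet> y)) * f x)"

definition fourier_inv :: "(real ^ 'n \<Rightarrow> complex) \<Rightarrow> real ^ 'n \<Rightarrow> complex" where
  "fourier_inv f x =
     (1 / (2 * complex_of_real pi) ^ CARD('n)) *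
     (LINT y|lborel. exp (\<i> * complex_of_real (x \<bullet> y)) * f y)"

definition square_integrable :: "(real ^ 'n \<Rightarrow> real) \<Rightarrow> bool" where
  "square_integrable f \<longleftrightarrow>
     f \<in> borel_measurable lborel \<and> integrable lborel (\<lambda>x. (f x)\<^sup>2)"

definition node :: "real ^ 'n ^ 'n \<Rightarrow> int ^ 'n \<Rightarrow> real ^ 'n" where
  "node A m = A *v real_vec m"

(* Series over the lattice are unordered sums. A spline is an element of L2 that is also evaluated
   at the nodes, so its series is required to converge to it both at every point and in the
   L2 norm. Pointwise convergence alone would not bound the coefficients, and fundamental splines
   would then not be unique (for a Gaussian kernel, for example). *)
definition SK :: "(real ^ 'n \<Rightarrow> real) \<Rightarrow> real ^ 'n ^ 'n \<Rightarrow> (real ^ 'n \<Rightarrow> real) set" where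
  "SK K A = {f. square_integrable f \<and>
     (\<exists>c :: int ^ 'n \<Rightarrow> real.
        (\<forall>x. ((\<lambda>m. c m * K (x - node A m)) has_sum f x) UNIV) \<and>
        ((\<lambda>M. \<integral>\<^sup>+x. ennreal ((f x - (\<Sum>m\<in>M. c m * K (x - node A m)))\<^sup>2) \<partial>lborel)
           \<longlongrightarrow> 0) (finite_subsets_at_top UNIV))}"

definition fundamental_spline ::
  "(real ^ 'n \<Rightarrow> real) \<Rightarrow> real ^ 'n ^ 'n \<Rightarrow> (real ^ 'n \<Rightarrow> real) \<Rightarrow> bool" where
  "fundamental_spline K A f \<longleftrightarrow>
     f \<in> SK K A \<and> (\<forall>s. f (node A s) = (if s = 0 then 1 else 0))"

(* The sum of the Fourier transform of K over the translates of z by 2 pi times the dual lattice. *)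
definition periodization :: "(real ^ 'n \<Rightarrow> real) \<Rightarrow> real ^ 'n ^ 'n \<Rightarrow> real ^ 'n \<Rightarrow> complex" where
  "periodization K A z =
     (\<Sum>\<^sub>\<infinity>m\<in>UNIV. fourier (\<lambda>x. complex_of_real (K x))
        (z + (2 * pi) *\<^sub>R (transpose (matrix_inv A) *v real_vec m)))"

end

theory Submission
  imports Defs
begin

text \<open>
  Write \<open>F\<close> for the Fourier transform of \<open>K\<close> and \<open>D(z) = \<Sum>m. K(A m) exp(-i \<langle>A m, z\<rangle>)\<close> for the denominator in the
  claimed formula (the sign of \<open>m\<close> is immaterial under the sum). Poisson summation identifies
  \<open>vol * D\<close> with the periodization of \<open>F\<close> over the dual lattice, where \<open>vol\<close> is the volume of a
  fundamental cell of the lattice (\<open>poisson_fourier\<close>, \<open>vol_symbol\<close>). So the two hypotheses on the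
  periodization say that \<open>D\<close> never vanishes and that \<open>1/D\<close> has a convergent Fourier series. Evaluated at
  \<open>z = 0\<close>, unconditional convergence in the complex plane is absolute convergence, so the
  coefficients \<open>d\<close> of \<open>1/D\<close> are absolutely summable; they may be taken real because \<open>D(-z)\<close> is
  the conjugate of \<open>D(z)\<close>. In other words, \<open>d\<close> is the inverse, for convolution over the integer
  lattice, of the sequence of samples \<open>K(A m)\<close> (\<open>d_convolution\<close>).

  Existence: \<open>\<Sum>m. d(m) K(x - A m)\<close> takes the values of that convolution at the nodes, hence is
  cardinal. It converges in \<open>L2\<close> because \<open>K\<close> is both bounded and integrable
  (\<open>cardinal_spline_tail_nn_integral\<close>).

  Uniqueness: \<open>L2\<close> convergence forces the coefficients \<open>c\<close> of any spline to be bounded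
  (\<open>spline_coeffs_bounded\<close>). A bounded sequence may be convolved with two summable ones in either
  order, so a sequence \<open>c\<close> inverse to the samples equals \<open>d\<close> (\<open>convolution_inverse_unique\<close>).

  Formula: expanding \<open>1/D\<close> in \<open>F/D\<close> and inverting the Fourier transform term by term gives
  \<open>\<Sum>m. d(m) K(x - A m)\<close> back (\<open>cardinal_spline_fourier_inv\<close>). This uses Fourier inversion for \<open>K\<close>,
  which follows from Poisson summation: for the translate \<open>K(a + x)\<close>, integrating both sides over a
  cell of the dual lattice leaves only the term \<open>K(a)\<close> on one side and turns the other side into an
  integral over the whole space.

  Poisson summation itself rests on two facts. The integral of a function over the whole space is the
  integral of its periodization over one cell (\<open>unfolding_integral\<close>), and a bounded function on a cell
  that is orthogonal to all characters vanishes at \<open>0\<close> if it is continuous there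
  (\<open>eq_0_if_orthogonal\<close>). The constant \<open>vol\<close> is never evaluated except for
  cubic lattices: it cancels everywhere else.
\<close>

section \<open>Series over the integer lattice\<close>

no_notation Infinite_Set_Sum.abs_summable_on (infix "abs'_summable'_on" 50)

lemma infinite_int_vec: "infinite (UNIV :: (int ^ 'n) set)"
proof
  assume "finite (UNIV :: (int ^ 'n) set)"
  then have "finite (range (vec :: int \<Rightarrow> int ^ 'n))" by (rule finite_subset[rotated]) simp
  moreover have "inj (vec :: int \<Rightarrow> int ^ 'n)" by (auto simp: inj_def vec_eq_iff)
  ultimately have "finite (UNIV :: int set)" by (rule finite_imageD)
  then show False by simp
qed

text \<open>
  An enumeration of the index type reduces the claim to dominated convergence for series over the
  natural numbers, because absolute convergence does not see the order of the terms.
\<close>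

lemma has_sum_integral:
  fixes f :: "'i::countable \<Rightarrow> 'a \<Rightarrow> 'b::{banach, second_countable_topology}"
  assumes inf: "infinite (UNIV :: 'i set)"
    and int: "\<And>i. integrable M (f i)"
    and ptw: "\<And>x. x \<in> space M \<Longrightarrow> (\<lambda>i. norm (f i x)) summable_on UNIV"
    and sm: "(\<lambda>i. \<integral>x. norm (f i x) \<partial>M) summable_on UNIV"
  shows "integrable M (\<lambda>x. \<Sum>\<^sub>\<infinity>i. f i x)"
    and "((\<lambda>i. \<integral>x. f i x \<partial>M) has_sum (\<integral>x. (\<Sum>\<^sub>\<infinity>i. f i x) \<partial>M)) UNIV"
proof -
  obtain b :: "nat \<Rightarrow> 'i" where b: "bij b"
    using inf by (metis bij_betw_from_nat_into countableI_type)
  have sum_nat: "summable (\<lambda>n. norm (f (b n) x))" if "x \<in> space M" for x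
    using ptw[OF that] b by (subst (asm) summable_on_reindex_bij_betw[OF b, symmetric]) (rule summable_on_imp_summable)
  have sum_int: "summable (\<lambda>n. \<integral>x. norm (f (b n) x) \<partial>M)"
    using sm b by (subst (asm) summable_on_reindex_bij_betw[OF b, symmetric]) (rule summable_on_imp_summable)
  have eq: "(\<Sum>\<^sub>\<infinity>i. f i x) = (\<Sum>n. f (b n) x)" if x: "x \<in> space M" for x
  proof -
    have "((\<lambda>n. f (b n) x) has_sum (\<Sum>n. f (b n) x)) UNIV"
      using sum_nat[OF x] summable_norm_cancel[OF sum_nat[OF x]] by (intro norm_summable_imp_has_sum) auto
    then have "((\<lambda>i. f i x) has_sum (\<Sum>n. f (b n) x)) UNIV"
      by (subst (asm) has_sum_reindex_bij_betw[OF b])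
    then show ?thesis by (rule infsumI)
  qed
  have int_eq: "integrable M (\<lambda>x. \<Sum>\<^sub>\<infinity>i. f i x) \<longleftrightarrow> integrable M (\<lambda>x. \<Sum>n. f (b n) x)"
    by (rule Bochner_Integration.integrable_cong) (auto simp: eq)
  have lint_eq: "(\<integral>x. (\<Sum>\<^sub>\<infinity>i. f i x) \<partial>M) = (\<integral>x. (\<Sum>n. f (b n) x) \<partial>M)"
    by (rule Bochner_Integration.integral_cong) (auto simp: eq)
  show "integrable M (\<lambda>x. \<Sum>\<^sub>\<infinity>i. f i x)"
    unfolding int_eq by (rule integrable_suminf) (use int sum_nat sum_int in auto)
  have "(\<lambda>n. \<integral>x. f (b n) x \<partial>M) sums (\<integral>x. (\<Sum>n. f (b n) x) \<partial>M)"
    by (rule sums_integral) (use int sum_nat sum_int in auto)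
  moreover have "summable (\<lambda>n. norm (\<integral>x. f (b n) x \<partial>M))"
    by (rule summable_comparison_test'[OF sum_int, of 0]) (use int in auto)
  ultimately have "((\<lambda>n. \<integral>x. f (b n) x \<partial>M) has_sum (\<integral>x. (\<Sum>n. f (b n) x) \<partial>M)) UNIV"
    by (intro norm_summable_imp_has_sum)
  then show "((\<lambda>i. \<integral>x. f i x \<partial>M) has_sum (\<integral>x. (\<Sum>\<^sub>\<infinity>i. f i x) \<partial>M)) UNIV"
    unfolding lint_eq by (subst (asm) has_sum_reindex_bij_betw[OF b])
qed

text \<open>
  A finite set of lattice points lies in a product of finite sets, over which the sum of the products
  is a product of one-dimensional sums.
\<close>

lemma summable_on_lattice_product:
  fixes \<phi> :: "int \<Rightarrow> real"
  assumes nn: "\<And>i. 0 \<le> \<phi> i" and sm: "\<phi> summable_on UNIV"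
  shows "(\<lambda>m :: int ^ 'n. \<Prod>k\<in>UNIV. \<phi> (m $ k)) summable_on UNIV"
proof (rule nonneg_bdd_above_summable_on)
  show "0 \<le> (\<Prod>k\<in>UNIV. \<phi> (m $ k))" for m :: "int ^ 'n"
    by (intro prod_nonneg) (use nn in auto)
  show "bdd_above (sum (\<lambda>m :: int ^ 'n. \<Prod>k\<in>UNIV. \<phi> (m $ k)) ` {F. F \<subseteq> UNIV \<and> finite F})"
  proof (rule bdd_aboveI2)
    fix F :: "(int ^ 'n) set" assume "F \<in> {F. F \<subseteq> UNIV \<and> finite F}"
    then have F: "finite F" by simp
    define J where "J k = (\<lambda>m. m $ k) ` F" for k
    have J: "finite (J k)" for k using F by (simp add: J_def)
    have "sum (\<lambda>m. \<Prod>k\<in>UNIV. \<phi> (m $ k)) F = (\<Sum>g\<in>vec_nth ` F. \<Prod>k\<in>UNIV. \<phi> (g k))"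
      by (subst sum.reindex) (auto simp: inj_on_def vec_nth_inject)
    also have "\<dots> \<le> (\<Sum>g\<in>PiE UNIV J. \<Prod>k\<in>UNIV. \<phi> (g k))"
      by (rule sum_mono2) (use J nn in \<open>auto intro!: finite_PiE prod_nonneg simp: J_def\<close>)
    also have "\<dots> = (\<Prod>k\<in>UNIV. \<Sum>i\<in>J k. \<phi> i)"
      by (rule prod_sum_PiE[symmetric]) (use J in auto)
    also have "\<dots> \<le> (\<Prod>k\<in>(UNIV :: 'n set). infsum \<phi> UNIV)"
      by (rule prod_mono) (use J nn sm in \<open>auto intro!: sum_nonneg finite_sum_le_infsum\<close>)
    finally show "sum (\<lambda>m. \<Prod>k\<in>UNIV. \<phi> (m $ k)) F \<le> (\<Prod>k\<in>(UNIV :: 'n set). infsum \<phi> UNIV)" .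
  qed
qed

lemma summable_on_int_powr:
  assumes "s > (1::real)"
  shows "(\<lambda>i::int. (1 + real_of_int \<bar>i\<bar>) powr - s) summable_on UNIV"
proof -
  have "summable (\<lambda>n. real (Suc n) powr - s)"
    using assms by (subst summable_Suc_iff) (simp add: summable_real_powr_iff)
  then have "(\<lambda>n. real (Suc n) powr - s) summable_on UNIV"
    by (intro norm_summable_imp_summable_on) simp
  then have N: "(\<lambda>n. (1 + real n) powr - s) summable_on UNIV" by (simp add: add.commute)
  have "(\<lambda>i::int. (1 + real_of_int \<bar>i\<bar>) powr - s) summable_on range int"
    using N by (subst summable_on_reindex) (auto simp: o_def inj_on_def)
  moreover have "(\<lambda>i::int. (1 + real_of_int \<bar>i\<bar>) powr - s) summable_on range (\<lambda>n. - int n)"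
    using N by (subst summable_on_reindex) (auto simp: o_def inj_on_def)
  ultimately have "(\<lambda>i::int. (1 + real_of_int \<bar>i\<bar>) powr - s) summable_on (range int \<union> range (\<lambda>n. - int n))"
    by (rule summable_on_union)
  moreover have "range int \<union> range (\<lambda>n. - int n) = UNIV"
  proof -
    have "i \<in> range int \<union> range (\<lambda>n. - int n)" for i by (cases i rule: int_cases2) auto
    then show ?thesis by blast
  qed
  ultimately show ?thesis by simp
qed

text \<open>
  The envelope that bounds both the kernel and its Fourier transform.
\<close>

definition decay :: "real \<Rightarrow> real ^ 'n \<Rightarrow> real" where
  "decay \<delta> x = (1 + norm x) powr (- real CARD('n) - \<delta>)"

lemma decay_nonneg: "0 \<le> decay \<delta> x" by (simp add: decay_def)

lemma decay_le_1: "\<delta> > 0 \<Longrightarrow> decay \<delta> x \<le> 1"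
proof -
  assume "\<delta> > 0"
  then have "(1 + norm x) powr (- real CARD('a) - \<delta>) \<le> (1 + norm x) powr 0"
    by (intro powr_mono) auto
  also have "\<dots> = 1"
    using norm_ge_zero[of x] by (intro powr_zero_eq_one[THEN trans]) (simp_all add: add_nonneg_eq_0_iff)
  finally show ?thesis by (simp add: decay_def)
qed

text \<open>
  Since \<open>1 + |m|\<close> dominates each \<open>1 + |m_k|\<close>, the exponent \<open>n + \<delta>\<close> can be shared out equally
  among the \<open>n\<close> coordinates. Each coordinate receives \<open>1 + \<delta>/n > 1\<close>, which is enough to sum over the
  integers.
\<close>

lemma summable_on_decay_lattice:
  assumes "\<delta> > 0"
  shows "(\<lambda>m :: int ^ 'n. decay \<delta> (real_vec m)) summable_on UNIV"
proof (rule summable_on_comparison_test)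
  let ?s = "1 + \<delta> / real CARD('n)"
  have n: "real CARD('n) > 0" by simp
  show "(\<lambda>m :: int ^ 'n. \<Prod>k\<in>UNIV. (1 + real_of_int \<bar>m $ k\<bar>) powr - ?s) summable_on UNIV"
    by (rule summable_on_lattice_product[OF _ summable_on_int_powr]) (use assms n in auto)
  show "0 \<le> decay \<delta> (real_vec m)" for m :: "int ^ 'n" by (rule decay_nonneg)
  show "decay \<delta> (real_vec m) \<le> (\<Prod>k\<in>UNIV. (1 + real_of_int \<bar>m $ k\<bar>) powr - ?s)" for m :: "int ^ 'n"
  proof -
    have "decay \<delta> (real_vec m) = (\<Prod>k\<in>(UNIV::'n set). (1 + norm (real_vec m)) powr - ?s)"
    proof -
      have "(1 + norm (real_vec m)) powr (- real CARD('n) - \<delta>) = ((1 + norm (real_vec m)) powr - ?s) powr real CARD('n)"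
      proof -
        have "- ?s * real CARD('n) = - real CARD('n) - \<delta>"
          by (simp add: left_diff_distrib)
        then show ?thesis by (simp only: powr_powr)
      qed
      also have "\<dots> = ((1 + norm (real_vec m)) powr - ?s) ^ CARD('n)"
        using norm_ge_zero[of "real_vec m"] by (intro powr_realpow) (simp add: add_nonneg_eq_0_iff)
      finally show ?thesis by (simp add: decay_def)
    qed
    also have "\<dots> \<le> (\<Prod>k\<in>UNIV. (1 + real_of_int \<bar>m $ k\<bar>) powr - ?s)"
    proof (intro prod_mono conjI)
      fix k
      have s: "0 \<le> ?s" using assms by (intro add_nonneg_nonneg divide_nonneg_nonneg) auto
      have "real_of_int \<bar>m $ k\<bar> \<le> norm (real_vec m)"
        using component_le_norm_cart[of "real_vec m" k] by (simp add: real_vec_def)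
      then show "(1 + norm (real_vec m)) powr - ?s \<le> (1 + real_of_int \<bar>m $ k\<bar>) powr - ?s"
        using s by (intro powr_mono2') auto
    qed auto
    finally show ?thesis .
  qed
qed

lemma decay_le_scaled:
  fixes u v :: "real ^ 'n"
  assumes \<delta>: "\<delta> > 0" and q: "q > 0" and uv: "1 + norm u \<le> q * (1 + norm v)"
  shows "decay \<delta> v \<le> q powr (real CARD('n) + \<delta>) * decay \<delta> u"
proof -
  let ?p = "- real CARD('n) - \<delta>"
  have "(q * (1 + norm v)) powr ?p \<le> (1 + norm u) powr ?p"
    using uv \<delta> by (intro powr_mono2') (auto simp: add_pos_nonneg)
  then have "q powr ?p * decay \<delta> v \<le> decay \<delta> u"
    using q by (simp add: powr_mult decay_def)
  then have "q powr - ?p * (q powr ?p * decay \<delta> v) \<le> q powr - ?p * decay \<delta> u"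
    by (rule mult_left_mono) simp
  moreover have "q powr - ?p * q powr ?p = 1"
    using q by (simp flip: powr_add)
  ultimately show ?thesis by (simp flip: mult.assoc add: add.commute)
qed

lemma decay_add:
  fixes a x :: "real ^ 'n"
  assumes "\<delta> > 0"
  shows "decay \<delta> (x + a) \<le> (1 + norm a) powr (real CARD('n) + \<delta>) * decay \<delta> x"
proof (rule decay_le_scaled[OF assms])
  show "0 < 1 + norm a" by (simp add: add_pos_nonneg)
  have "norm x \<le> norm (x + a) + norm a"
    using norm_triangle_ineq4[of "x + a" a] by simp
  moreover have "(1 + norm a) * (1 + norm (x + a)) = 1 + norm a + norm (x + a) + norm a * norm (x + a)"
    by (simp add: algebra_simps)
  moreover have "0 \<le> norm a * norm (x + a)" by simp
  ultimately show "1 + norm x \<le> (1 + norm a) * (1 + norm (x + a))" by linarith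
qed

lemma decay_bounded_below:
  fixes x :: "real ^ 'n"
  assumes "\<delta> > 0" "norm x \<le> R"
  shows "1 \<le> (1 + R) powr (real CARD('n) + \<delta>) * decay \<delta> x"
proof -
  have "R \<ge> 0" using norm_ge_zero[of x] assms(2) by linarith
  then have "(1 + R) powr (- real CARD('n) - \<delta>) \<le> decay \<delta> x"
    unfolding decay_def using assms by (intro powr_mono2') (auto simp: add_pos_nonneg)
  then have "(1 + R) powr (real CARD('n) + \<delta>) * (1 + R) powr (- real CARD('n) - \<delta>)
      \<le> (1 + R) powr (real CARD('n) + \<delta>) * decay \<delta> x"
    by (rule mult_left_mono) simp
  then show ?thesis using \<open>R \<ge> 0\<close> by (simp flip: powr_add)
qed

text \<open>
  On a bounded set the translates by lattice points are dominated by a summable sequence that does not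
  depend on the point: \<open>|m|\<close> is at most a constant times \<open>|A m|\<close>, as \<open>A\<close> is invertible, and
  \<open>|A m|\<close> differs from \<open>|x + A m|\<close> by at most the radius.
\<close>

lemma decay_translate:
  fixes A B :: "real ^ 'n ^ 'n"
  assumes AB: "A ** B = mat 1" and \<delta>: "\<delta> > 0"
  obtains L where "L > 0"
    "\<And>x m. norm x \<le> R \<Longrightarrow> decay \<delta> (x + node A m) \<le> L * decay \<delta> (real_vec m)"
proof -
  have BA: "B ** A = mat 1" using AB by (simp add: matrix_left_right_inverse)
  obtain \<beta> where \<beta>: "\<beta> > 0" "\<And>v. norm (B *v v) \<le> norm v * \<beta>"
    using bounded_linear.pos_bounded[OF matrix_vector_mul_bounded_linear[of B]] by blast
  define q where "q = 1 + \<beta> * (1 + \<bar>R\<bar>)"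
  have q: "q > 0" using \<beta> by (simp add: q_def add_pos_nonneg)
  show thesis
  proof (rule that[of "q powr (real CARD('n) + \<delta>)"])
    show "0 < q powr (real CARD('n) + \<delta>)" using q by simp
    fix x :: "real ^ 'n" and m :: "int ^ 'n"
    assume x: "norm x \<le> R"
    have "norm (real_vec m) = norm (B *v node A m)"
      by (simp add: node_def matrix_vector_mul_assoc BA)
    also have "\<dots> \<le> norm (node A m) * \<beta>" by (rule \<beta>)
    also have "norm (node A m) \<le> norm (x + node A m) + \<bar>R\<bar>"
      using norm_triangle_ineq4[of "x + node A m" x] x by simp
    finally have "norm (real_vec m) \<le> (norm (x + node A m) + \<bar>R\<bar>) * \<beta>"
      using \<beta> by (simp add: mult_right_mono)
    then have "1 + norm (real_vec m) \<le> q * (1 + norm (x + node A m))"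
    proof -
      have "(norm (x + node A m) + \<bar>R\<bar>) * \<beta> \<le> \<beta> * (1 + \<bar>R\<bar>) * (1 + norm (x + node A m))"
        using \<beta> by (simp add: algebra_simps mult_nonneg_nonneg)
      with \<open>norm (real_vec m) \<le> _\<close> show ?thesis
        unfolding q_def by (simp add: distrib_right) (smt (verit) norm_ge_zero)
    qed
    then show "decay \<delta> (x + node A m) \<le> q powr (real CARD('n) + \<delta>) * decay \<delta> (real_vec m)"
      by (rule decay_le_scaled[OF \<delta> q])
  qed
qed

lemma decay_bound_nonneg:
  fixes g :: "real ^ 'n \<Rightarrow> 'b::real_normed_vector"
  assumes "\<And>x. norm (g x) \<le> C * decay \<delta> x"
  shows "C \<ge> 0"
proof -
  have "0 \<le> C * decay \<delta> (0::real^'n)" by (rule order_trans[OF norm_ge_zero assms])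
  then show ?thesis by (simp add: decay_def)
qed

section \<open>Lattices, fundamental cells and characters\<close>

lemma integral_translate:
  fixes f :: "'a::euclidean_space \<Rightarrow> 'b::{banach, second_countable_topology}"
  assumes [measurable]: "f \<in> borel_measurable borel"
  shows "(LINT x|lborel. f (x + c)) = (LINT x|lborel. f x)"
    and "integrable lborel (\<lambda>x. f (x + c)) \<longleftrightarrow> integrable lborel f"
proof -
  have [measurable]: "(+) c \<in> measurable lborel borel" by simp
  have "(LINT x|lborel. f x) = (LINT x|distr lborel borel ((+) c). f x)"
    by (simp add: lborel_distr_plus)
  also have "\<dots> = (LINT x|lborel. f (c + x))"
    by (rule integral_distr) auto
  finally show "(LINT x|lborel. f (x + c)) = (LINT x|lborel. f x)" by (simp add: add.commute)
  have "integrable lborel f \<longleftrightarrow> integrable (distr lborel borel ((+) c)) f"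
    by (simp add: lborel_distr_plus)
  also have "\<dots> \<longleftrightarrow> integrable lborel (\<lambda>x. f (c + x))"
    by (rule integrable_distr_eq) auto
  finally show "integrable lborel (\<lambda>x. f (x + c)) \<longleftrightarrow> integrable lborel f"
    by (simp add: add.commute)
qed

lemma real_vec_simps [simp]:
  "real_vec 0 = 0" "real_vec (a + b) = real_vec a + real_vec b"
  "real_vec (a - b) = real_vec a - real_vec b" "real_vec (- a) = - real_vec a"
  by (simp_all add: real_vec_def vec_eq_iff)

lemma real_vec_eq_0_iff [simp]: "real_vec a = 0 \<longleftrightarrow> a = 0"
  by (simp add: real_vec_def vec_eq_iff)

lemma node_simps [simp]:
  "node A 0 = 0" "node A (a + b) = node A a + node A b"
  "node A (a - b) = node A a - node A b" "node A (- a) = - node A a"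
  by (simp_all add: node_def matrix_vector_right_distrib matrix_vector_mult_diff_distrib
      linear_neg matrix_vector_mul_linear)

lemma inner_real_vec_Ints: "real_vec a \<bullet> real_vec b \<in> \<int>"
  by (auto simp: real_vec_def inner_vec_def)

lemma continuous_on_matrix_vector [continuous_intros]:
  fixes A :: "real ^ 'n ^ 'm"
  shows "continuous_on S f \<Longrightarrow> continuous_on S (\<lambda>x. A *v f x)"
  by (rule bounded_linear.continuous_on[OF matrix_vector_mul_bounded_linear])

lemma borel_measurable_matrix_vector [measurable]:
  fixes A :: "real ^ 'n ^ 'm"
  shows "(\<lambda>x. A *v x) \<in> borel_measurable borel"
  by (intro borel_measurable_continuous_onI continuous_intros)

text \<open>
  The lattice consists of the points \<open>A m\<close> for integer vectors \<open>m\<close>. The inverse \<open>B\<close> is a parameter of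
  its own, so that the dual lattice, generated by \<open>2 pi\<close> times the transpose of \<open>B\<close>, is an instance
  without a computation of matrix inverses.
\<close>

locale lattice =
  fixes A B :: "real ^ 'n ^ 'n"
  assumes AB: "A ** B = mat 1"
begin

lemma BA: "B ** A = mat 1"
  using AB by (simp add: matrix_left_right_inverse)

lemma A_B_cancel [simp]: "A *v (B *v x) = x"
  by (simp add: matrix_vector_mul_assoc AB)

lemma B_A_cancel [simp]: "B *v (A *v x) = x"
  by (simp add: matrix_vector_mul_assoc BA)

lemma B_node [simp]: "B *v node A m = real_vec m"
  by (simp add: node_def)

definition cell :: "(real ^ 'n) set" where
  "cell = {x. \<forall>k. - 1 / 2 \<le> (B *v x) $ k \<and> (B *v x) $ k < 1 / 2}"

definition \<mu> :: "(real ^ 'n) measure" where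
  "\<mu> = restrict_space lborel cell"

definition vol :: real where
  "vol = measure lborel cell"

text \<open>
  The characters that are trivial on the lattice: \<open>chr m\<close> is \<open>exp(i \<langle>y, x\<rangle>)\<close> for the point
  \<open>y\<close> with index \<open>m\<close> of the dual lattice.
\<close>

definition chr :: "int ^ 'n \<Rightarrow> real ^ 'n \<Rightarrow> complex" where
  "chr m x = cis (2 * pi * (real_vec m \<bullet> (B *v x)))"

lemma cell_borel [measurable]: "cell \<in> sets borel"
  unfolding cell_def by measurable

lemma cell_bounded: obtains R where "R > 0" "\<And>x. x \<in> cell \<Longrightarrow> norm x \<le> R"
proof -
  obtain a where a: "a > 0" "\<And>v. norm (A *v v) \<le> norm v * a"
    using bounded_linear.pos_bounded[OF matrix_vector_mul_bounded_linear[of A]] by blast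
  have "norm x \<le> real CARD('n) * a" if "x \<in> cell" for x
  proof -
    have "norm (B *v x) \<le> (\<Sum>k\<in>UNIV. \<bar>(B *v x) $ k\<bar>)" by (rule norm_le_l1_cart)
    also have "\<dots> \<le> (\<Sum>k\<in>(UNIV::'n set). 1)"
    proof (rule sum_mono)
      fix k
      from that have "- 1 / 2 \<le> (B *v x) $ k \<and> (B *v x) $ k < 1 / 2" by (simp add: cell_def)
      then show "\<bar>(B *v x) $ k\<bar> \<le> 1" by auto
    qed
    finally have "norm (B *v x) \<le> real CARD('n)" by simp
    then have "norm (B *v x) * a \<le> real CARD('n) * a" using a by (intro mult_right_mono) auto
    with a(2)[of "B *v x"] show ?thesis by simp
  qed
  with a show thesis by (intro that[of "real CARD('n) * a"]) auto
qed

lemma cell_nbhd: obtains r where "r > 0" "\<And>x. norm x < r \<Longrightarrow> x \<in> cell"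
proof -
  obtain b where b: "b > 0" "\<And>v. norm (B *v v) \<le> norm v * b"
    using bounded_linear.pos_bounded[OF matrix_vector_mul_bounded_linear[of B]] by blast
  have "x \<in> cell" if x: "norm x < 1 / (2 * b)" for x
  proof -
    have "norm x * b < 1 / 2" using x b by (simp add: field_simps)
    then have "- 1 / 2 \<le> (B *v x) $ k \<and> (B *v x) $ k < 1 / 2" for k
      using b(2)[of x] component_le_norm_cart[of "B *v x" k] by (intro conjI; linarith)
    then show ?thesis by (simp add: cell_def)
  qed
  with b show thesis by (intro that[of "1 / (2 * b)"]) auto
qed

lemma emeasure_cell_finite: "emeasure lborel cell < \<infinity>"
proof -
  have "bounded cell" using cell_bounded by (metis boundedI)
  then show ?thesis by (rule emeasure_bounded_finite)
qed

lemma space_\<mu> [simp]: "space \<mu> = cell"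
  by (simp add: \<mu>_def space_restrict_space)

lemma measurable_\<mu>:
  "f \<in> borel_measurable borel \<Longrightarrow> f \<in> borel_measurable \<mu>"
  unfolding \<mu>_def by (rule measurable_restrict_space1) simp

sublocale \<mu>: finite_measure \<mu>
proof
  show "emeasure \<mu> (space \<mu>) \<noteq> \<infinity>"
    using emeasure_cell_finite by (simp add: \<mu>_def emeasure_restrict_space space_restrict_space)
qed

lemma measure_\<mu>: "measure \<mu> cell = vol"
  by (simp add: \<mu>_def vol_def measure_restrict_space)

lemma vol_pos: "vol > 0"
proof -
  obtain r where r: "r > 0" "\<And>x. norm x < r \<Longrightarrow> x \<in> cell" using cell_nbhd by blast
  have "0 < measure lborel (ball (0::real^'n) r)"
    using r content_ball_pos[of r 0] by (simp add: measure_completion)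
  also have "\<dots> \<le> vol"
    unfolding vol_def using r emeasure_cell_finite
    by (intro measure_mono_fmeasurable) (auto simp: fmeasurable_def)
  finally show ?thesis .
qed

lemma integral_\<mu>:
  fixes f :: "real ^ 'n \<Rightarrow> 'b::{banach, second_countable_topology}"
  shows "(LINT x|\<mu>. f x) = (LINT x|lborel. indicator cell x *\<^sub>R f x)"
  unfolding \<mu>_def by (rule integral_restrict_space) simp

lemma integrable_\<mu>_bounded:
  fixes f :: "real ^ 'n \<Rightarrow> 'b::{banach, second_countable_topology}"
  assumes "f \<in> borel_measurable borel" "\<And>x. x \<in> cell \<Longrightarrow> norm (f x) \<le> M"
  shows "integrable \<mu> f"
  by (rule \<mu>.integrable_const_bound[of _ M]) (use assms in \<open>auto intro!: measurable_\<mu>\<close>)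

text \<open>
  The index is found by rounding the lattice coordinates \<open>B x\<close> to the nearest integers; the half-open
  cell breaks ties.
\<close>

lemma ex1_cell: "\<exists>!m. x - node A m \<in> cell"
proof -
  have *: "x - node A m \<in> cell \<longleftrightarrow> m = (\<chi> k. \<lfloor>(B *v x) $ k + 1 / 2\<rfloor>)" for m
  proof -
    have "x - node A m \<in> cell \<longleftrightarrow> (\<forall>k. \<lfloor>(B *v x) $ k + 1 / 2\<rfloor> = m $ k)"
    proof -
      have "(- 1 / 2 \<le> t - c \<and> t - c < 1 / 2) \<longleftrightarrow> (c \<le> t + 1 / 2 \<and> t + 1 / 2 < c + 1)" for t c :: real
        by linarith
      then show ?thesis
        unfolding floor_eq_iff cell_def
        by (simp add: matrix_vector_mult_diff_distrib real_vec_def)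
    qed
    then show ?thesis by (auto simp: vec_eq_iff)
  qed
  show ?thesis unfolding * by simp
qed

lemma norm_chr [simp]: "norm (chr m x) = 1" by (simp add: chr_def)

lemma chr_0 [simp]: "chr 0 x = 1" "chr m 0 = 1" by (simp_all add: chr_def)

lemma chr_add: "chr (a + b) x = chr a x * chr b x"
  by (simp add: chr_def cis_mult inner_add_left distrib_left)

lemma chr_add_right: "chr m (x + y) = chr m x * chr m y"
  by (simp add: chr_def cis_mult inner_add_right matrix_vector_right_distrib distrib_left)

lemma chr_uminus: "chr (- m) x = cnj (chr m x)"
  by (simp add: chr_def cis_cnj)

lemma chr_uminus_right: "chr m (- x) = cnj (chr m x)"
  by (simp add: chr_def cis_cnj linear_neg)

lemma chr_node: "chr m (node A j) = 1"
proof -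
  have "cis (2 * pi * (real_vec m \<bullet> real_vec j)) = 1"
    using inner_real_vec_Ints[of m j] by (rule cis_multiple_2pi)
  then show ?thesis by (simp add: chr_def)
qed

lemma chr_periodic [simp]: "chr m (x + node A j) = chr m x"
  by (simp add: chr_add_right chr_node)

lemma continuous_on_chr [continuous_intros]: "continuous_on S (chr m)"
  unfolding chr_def by (intro continuous_intros)

lemma measurable_chr [measurable]: "chr m \<in> borel_measurable borel"
  by (intro borel_measurable_continuous_onI continuous_intros)

lemma summable_majorant:
  fixes g :: "real ^ 'n \<Rightarrow> 'b::real_normed_vector"
  assumes \<delta>: "\<delta> > 0" and g: "\<And>x. norm (g x) \<le> C * decay \<delta> x"
  obtains W where "W summable_on UNIV" "\<And>x m. norm x \<le> R \<Longrightarrow> norm (g (x + node A m)) \<le> W m"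
proof -
  obtain L where L: "L > 0" "\<And>x m. norm x \<le> R \<Longrightarrow> decay \<delta> (x + node A m) \<le> L * decay \<delta> (real_vec m)"
    using decay_translate[OF AB \<delta>] by blast
  show thesis
  proof
    show "(\<lambda>m. C * (L * decay \<delta> (real_vec m))) summable_on UNIV"
      by (intro summable_on_cmult_right summable_on_decay_lattice \<delta>)
    show "norm (g (x + node A m)) \<le> C * (L * decay \<delta> (real_vec m))" if "norm x \<le> R" for x m
      using L(2)[OF that] decay_bound_nonneg[OF g] by (intro order_trans[OF g] mult_left_mono)
  qed
qed

lemma summable_on_translates:
  fixes g :: "real ^ 'n \<Rightarrow> 'b::real_normed_vector"
  assumes "\<delta> > 0" and "\<And>x. norm (g x) \<le> C * decay \<delta> x"
  shows "(\<lambda>m. norm (g (x + node A m))) summable_on UNIV"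
proof -
  obtain W where W: "W summable_on UNIV" "\<And>m. norm (g (x + node A m)) \<le> W m"
    using summable_majorant[OF assms, of "norm x"] by (metis order_refl)
  show ?thesis by (rule summable_on_comparison_test[OF W]) auto
qed

text \<open>
  The translates of the cell tile the space, so that \<open>g\<close> is the sum over \<open>m\<close> of its restrictions to
  these translates. The decay of \<open>g\<close> makes the series of their integrals absolutely convergent, and each
  restriction is moved back to the cell by translation.
\<close>

lemma unfolding_integral:
  fixes g :: "real ^ 'n \<Rightarrow> complex"
  assumes [measurable]: "g \<in> borel_measurable borel" and \<delta>: "\<delta> > 0"
    and g: "\<And>x. norm (g x) \<le> C * decay \<delta> x"
  shows "integrable lborel g"
    and "(LINT x|lborel. g x) = (LINT x|\<mu>. (\<Sum>\<^sub>\<infinity>m. g (x + node A m)))"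
proof -
  obtain R where R: "R > 0" "\<And>x. x \<in> cell \<Longrightarrow> norm x \<le> R" using cell_bounded by blast
  obtain W where W: "W summable_on UNIV" "\<And>x m. norm x \<le> R \<Longrightarrow> norm (g (x + node A m)) \<le> W m"
    using summable_majorant[OF \<delta> g] by blast
  have gW: "norm (g (x + node A m)) \<le> W m" if "x \<in> cell" for x m
    using W(2)[OF R(2)[OF that]] .
  have meas: "(\<lambda>x. g (x + node A m)) \<in> borel_measurable borel" for m by measurable
  have int_f: "integrable \<mu> (\<lambda>x. g (x + node A m))" for m
    by (rule integrable_\<mu>_bounded[of _ "W m"]) (use gW meas in auto)
  have W_vol: "(LINT x|\<mu>. norm (g (x + node A m))) \<le> W m * vol" for m
  proof -
    have "(LINT x|\<mu>. norm (g (x + node A m))) \<le> (LINT x|\<mu>. W m)"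
      using int_f gW by (intro integral_mono) auto
    then show ?thesis by (simp add: measure_\<mu> mult.commute)
  qed
  have sm: "(\<lambda>m. LINT x|\<mu>. norm (g (x + node A m))) summable_on UNIV"
    by (rule summable_on_comparison_test[OF summable_on_cmult_left[OF W(1), of vol]]) (use W_vol in auto)
  have ptw: "(\<lambda>m. norm (g (x + node A m))) summable_on UNIV" for x
    by (rule summable_on_translates[OF \<delta> g])
  have 1: "((\<lambda>m. LINT x|\<mu>. g (x + node A m)) has_sum (LINT x|\<mu>. (\<Sum>\<^sub>\<infinity>m. g (x + node A m)))) UNIV"
    by (rule has_sum_integral[OF infinite_int_vec]) (use int_f sm ptw in auto)
  define h where "h m x = indicator cell (x - node A m) *\<^sub>R g x" for m x
  have h_meas [measurable]: "h m \<in> borel_measurable borel" for m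
    unfolding h_def by measurable
  have h_shift: "(\<lambda>x. h m (x + node A m)) = (\<lambda>x. indicator cell x *\<^sub>R g (x + node A m))" for m
    by (simp add: h_def)
  have h_int: "integrable lborel (h m)" for m
  proof -
    have "integrable lborel (\<lambda>x. h m (x + node A m))"
      unfolding h_shift using int_f[of m] by (simp add: \<mu>_def integrable_restrict_space)
    then show ?thesis using integral_translate(2)[OF h_meas] by blast
  qed
  have h_eq: "(LINT x|lborel. h m x) = (LINT x|\<mu>. g (x + node A m))" for m
    using integral_translate(1)[OF h_meas, of m "node A m"] unfolding h_shift integral_\<mu> by (rule sym)
  have h_norm: "(LINT x|lborel. norm (h m x)) = (LINT x|\<mu>. norm (g (x + node A m)))" for m
  proof -
    have "(\<lambda>x. norm (h m x)) \<in> borel_measurable borel" by measurable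
    from integral_translate(1)[OF this, of "node A m"]
    have "(LINT x|lborel. norm (h m x)) = (LINT x|lborel. norm (h m (x + node A m)))" by (rule sym)
    also have "\<dots> = (LINT x|lborel. indicator cell x *\<^sub>R norm (g (x + node A m)))"
      by (rule Bochner_Integration.integral_cong) (simp_all add: h_def)
    also have "\<dots> = (LINT x|\<mu>. norm (g (x + node A m)))" by (rule integral_\<mu>[symmetric])
    finally show ?thesis .
  qed
  have h_sum: "((\<lambda>m. h m x) has_sum g x) UNIV" for x
  proof -
    obtain m where m: "x - node A m \<in> cell" "\<And>j. x - node A j \<in> cell \<Longrightarrow> j = m"
      using ex1_cell[of x] by blast
    show ?thesis
    proof (rule has_sum_finite_neutralI[of "{m}"])
      show "h j x = 0" if "j \<in> UNIV - {m}" for j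
      proof -
        have "x - node A j \<notin> cell" using m(2)[of j] that by blast
        then show ?thesis by (simp add: h_def)
      qed
      show "g x = (\<Sum>j\<in>{m}. h j x)" using m(1) by (simp add: h_def)
    qed auto
  qed
  have h_abs: "(\<lambda>m. norm (h m x)) summable_on UNIV" for x
    using has_sum_imp_summable[OF h_sum[of x]] by (simp add: summable_on_iff_abs_summable_on_complex)
  have inf: "(\<lambda>x. \<Sum>\<^sub>\<infinity>m. h m x) = g" using h_sum by (auto simp: infsumI)
  note 2 = has_sum_integral[OF infinite_int_vec h_int h_abs, unfolded h_norm h_eq inf, OF sm]
  show "integrable lborel g" by (rule 2(1))
  show "(LINT x|lborel. g x) = (LINT x|\<mu>. (\<Sum>\<^sub>\<infinity>m. g (x + node A m)))"
    using 2(2) 1 by (rule has_sum_unique)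
qed

text \<open>
  For \<open>m \<noteq> 0\<close> some translation by \<open>t\<close> multiplies the character by \<open>-1\<close>. The integral of a periodic
  function over the cell equals its integral over the shifted cell, by unfolding the function cut
  off to the shifted cell. Hence the integral equals its own negative.
\<close>

lemma integral_chr: "(LINT x|\<mu>. chr m x) = (if m = 0 then of_real vol else 0)"
proof (cases "m = 0")
  case True
  then show ?thesis by (simp add: measure_\<mu> scaleR_conv_of_real)
next
  case False
  \<comment> \<open>Chosen such that the phase of the character at \<open>t\<close> is half a period.\<close>
  define t where "t = A *v ((1 / (2 * (real_vec m \<bullet> real_vec m))) *\<^sub>R real_vec m)"
  have "real_vec m \<noteq> 0" using False by simp
  then have "real_vec m \<bullet> real_vec m \<noteq> 0" by simp
  moreover have "B *v t = (1 / (2 * (real_vec m \<bullet> real_vec m))) *\<^sub>R real_vec m"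
    unfolding t_def by (rule B_A_cancel)
  ultimately have half: "real_vec m \<bullet> (B *v t) = 1 / 2" by simp
  have "chr m t = cis pi" unfolding chr_def half by simp
  then have t: "chr m (- t) = - 1" by (simp add: chr_uminus_right)
  define g where "g x = indicator cell (x + t) *\<^sub>R chr m x" for x
  have g_meas [measurable]: "g \<in> borel_measurable borel" unfolding g_def by measurable
  obtain R where R: "R > 0" "\<And>x. x \<in> cell \<Longrightarrow> norm x \<le> R" using cell_bounded by blast
  have "norm (g x) \<le> (1 + (R + norm t)) powr (real CARD('n) + 1) * decay 1 x" for x
  proof (cases "x + t \<in> cell")
    case True
    then have "norm x \<le> R + norm t"
      using R(2)[OF True] norm_triangle_ineq4[of "x + t" t] by simp
    then show ?thesis using True decay_bounded_below[of 1 x] by (simp add: g_def)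
  next
    case False
    then show ?thesis using decay_nonneg[of 1 x] by (simp add: g_def)
  qed
  then have "(LINT x|lborel. g x) = (LINT x|\<mu>. (\<Sum>\<^sub>\<infinity>j. g (x + node A j)))"
    by (intro unfolding_integral(2)[OF g_meas, of 1]) auto
  also have "(\<lambda>x. \<Sum>\<^sub>\<infinity>j. g (x + node A j)) = chr m"
  proof
    fix x
    obtain j where j: "x + t - node A j \<in> cell" "\<And>i. x + t - node A i \<in> cell \<Longrightarrow> i = j"
      using ex1_cell[of "x + t"] by blast
    have "((\<lambda>j. g (x + node A j)) has_sum chr m x) UNIV"
    proof (rule has_sum_finite_neutralI[of "{- j}"])
      show "g (x + node A i) = 0" if "i \<in> UNIV - {- j}" for i
      proof -
        have eq: "x + node A i + t = x + t - node A (- i)" by simp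
        have "- i \<noteq> j" using that by auto
        then have "x + node A i + t \<notin> cell" using j(2)[of "- i"] unfolding eq by blast
        then show ?thesis by (simp add: g_def)
      qed
      show "chr m x = (\<Sum>i\<in>{- j}. g (x + node A i))"
      proof -
        have "chr m (x + node A (- j)) = chr m x" by (rule chr_periodic)
        moreover have eq: "x + node A (- j) + t = x + t - node A j" by simp
        have "x + node A (- j) + t \<in> cell" using j(1) unfolding eq .
        ultimately show ?thesis by (simp add: g_def del: node_simps)
      qed
    qed auto
    then show "(\<Sum>\<^sub>\<infinity>j. g (x + node A j)) = chr m x" by (rule infsumI)
  qed
  finally have "(LINT x|\<mu>. chr m x) = (LINT x|lborel. g x)" by simp
  also have "\<dots> = (LINT x|lborel. g (x + - t))"
    by (rule integral_translate(1)[symmetric]) measurable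
  also have "\<dots> = (LINT x|lborel. indicator cell x *\<^sub>R (chr m x * chr m (- t)))"
    unfolding g_def chr_add_right by simp
  also have "\<dots> = - (LINT x|\<mu>. chr m x)"
    unfolding t integral_\<mu> by simp
  finally show ?thesis using False by simp
qed

end

section \<open>Fourier coefficients of periodic functions\<close>

lemma half_one_plus_cos: "0 \<le> (1 + cos t) / 2" "(1 + cos t) / 2 \<le> (1::real)"
proof -
  have "0 \<le> 1 + cos t" using cos_ge_minus_one[of t] by linarith
  then show "0 \<le> (1 + cos t) / 2" by simp
  show "(1 + cos t) / 2 \<le> 1" using cos_le_one[of t] by simp
qed

lemma cos_2pi_less_1:
  assumes "t \<noteq> 0" "\<bar>t\<bar> \<le> 1 / 2"
  shows "cos (2 * pi * t) < 1"
proof -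
  have "cos (2 * pi * t) = cos (2 * pi * \<bar>t\<bar>)" by (cases "t \<ge> 0") auto
  also have "\<dots> < cos 0"
    using assms mult_left_mono[OF assms(2), of "2 * pi"] by (intro cos_monotone_0_pi) auto
  finally show ?thesis by simp
qed

context lattice
begin

lemma integral_chr_series:
  assumes b: "(\<lambda>m. norm (b m)) summable_on UNIV"
  shows "(LINT x|\<mu>. (\<Sum>\<^sub>\<infinity>m. b m * chr m x) * chr (- j) x) = b j * of_real vol"
proof -
  have eq: "(\<Sum>\<^sub>\<infinity>m. b m * chr m x) * chr (- j) x = (\<Sum>\<^sub>\<infinity>m. b m * chr (m - j) x)" for x
  proof -
    have "(\<Sum>\<^sub>\<infinity>m. b m * chr m x) * chr (- j) x = (\<Sum>\<^sub>\<infinity>m. b m * chr m x * chr (- j) x)"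
      by (rule infsum_cmult_left'[symmetric])
    then show ?thesis by (simp add: mult.assoc flip: chr_add)
  qed
  have int: "integrable \<mu> (\<lambda>x. b m * chr (m - j) x)" for m
    by (rule integrable_\<mu>_bounded[of _ "norm (b m)"]) (auto simp: norm_mult)
  have "((\<lambda>m. LINT x|\<mu>. b m * chr (m - j) x) has_sum
      (LINT x|\<mu>. (\<Sum>\<^sub>\<infinity>m. b m * chr (m - j) x))) UNIV"
    by (rule has_sum_integral(2)[OF infinite_int_vec int])
      (use b in \<open>auto simp: norm_mult measure_\<mu> intro!: summable_on_cmult_right\<close>)
  moreover have "(LINT x|\<mu>. b m * chr (m - j) x) = (if m = j then b j * of_real vol else 0)" for m
    by (simp add: integral_chr)
  moreover have "((\<lambda>m. if m = j then b j * of_real vol else 0) has_sum b j * of_real vol) UNIV"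
    by (rule has_sum_finite_neutralI[of "{j}"]) auto
  ultimately show ?thesis unfolding eq using has_sum_unique by fastforce
qed

text \<open>
  A nonnegative trigonometric polynomial that attains its maximum \<open>1\<close> exactly at the lattice points.
  Its powers concentrate at these points.
\<close>

definition bump :: "real ^ 'n \<Rightarrow> real" where
  "bump x = (\<Prod>k\<in>UNIV. (1 + cos (2 * pi * (B *v x) $ k)) / 2)"

lemma bump_nonneg: "0 \<le> bump x"
  unfolding bump_def by (intro prod_nonneg half_one_plus_cos)

lemma bump_0: "bump 0 = 1"
  by (simp add: bump_def)

lemma continuous_on_bump [continuous_intros]: "continuous_on S bump"
  unfolding bump_def by (intro continuous_intros) auto

lemma bump_less_1:
  assumes "x \<noteq> 0" "\<And>k. \<bar>(B *v x) $ k\<bar> \<le> 1 / 2"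
  shows "bump x < 1"
proof -
  have "B *v x \<noteq> 0" using assms(1) A_B_cancel[of x] by (metis matrix_vector_mult_0_right)
  then obtain k where k: "(B *v x) $ k \<noteq> 0" by (auto simp: vec_eq_iff)
  let ?c = "\<lambda>k. (1 + cos (2 * pi * (B *v x) $ k)) / 2"
  have c: "0 \<le> ?c k \<and> ?c k \<le> 1" for k
    using half_one_plus_cos by blast
  have "bump x = ?c k * (\<Prod>k\<in>UNIV - {k}. ?c k)"
    unfolding bump_def by (rule prod.remove) auto
  also have "\<dots> \<le> ?c k * 1"
    using c by (intro mult_left_mono prod_le_1) auto
  also have "\<dots> < 1" using cos_2pi_less_1[OF k assms(2)] by simp
  finally show ?thesis .
qed

lemma chr_axis_cos:
  "complex_of_real ((1 + cos (2 * pi * (B *v x) $ k)) / 2)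
    = 1 / 2 + (chr (axis k 1) x + chr (- axis k 1) x) / 4"
proof -
  have "real_vec (axis k 1) = axis k 1"
    by (simp add: real_vec_def vec_eq_iff axis_def)
  then have "chr (axis k 1) x = cis (2 * pi * (B *v x) $ k)"
    by (simp add: chr_def inner_axis' inner_axis)
  moreover have "chr (- axis k 1) x = cnj (chr (axis k 1) x)" by (rule chr_uminus)
  ultimately show ?thesis by (simp add: complex_eq_iff)
qed

text \<open>
  Each factor of the bump is a combination of the constant and two characters, and products of
  characters are characters. Orthogonality to all characters therefore survives multiplication of the
  test function by one more factor, which allows induction on the factors and on the power.
\<close>

lemma bump_power_orthogonal:
  fixes F :: "real ^ 'n \<Rightarrow> complex"
  assumes [measurable]: "F \<in> borel_measurable borel"
    and bdd: "\<And>x. x \<in> cell \<Longrightarrow> norm (F x) \<le> M"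
    and orth: "\<And>m. (LINT x|\<mu>. F x * chr m x) = 0"
  shows "(LINT x|\<mu>. F x * of_real (bump x ^ N)) = 0"
proof -
  define Z where "Z h \<longleftrightarrow> (h \<in> borel_measurable borel \<and> (\<forall>x. norm (h x) \<le> 1) \<and>
    (\<forall>m. (LINT x|\<mu>. F x * h x * chr m x) = 0))" for h :: "real ^ 'n \<Rightarrow> complex"
  let ?c = "\<lambda>k x. (1 + cos (2 * pi * (B *v x) $ k)) / 2"
  have step: "Z (\<lambda>x. h x * of_real (?c k x))" if "Z h" for h k
  proof -
    have h [measurable]: "h \<in> borel_measurable borel" and h1: "\<And>x. norm (h x) \<le> 1"
      and h0: "\<And>m. (LINT x|\<mu>. F x * h x * chr m x) = 0" using that by (auto simp: Z_def)
    have int: "integrable \<mu> (\<lambda>x. F x * h x * chr m x)" for m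
    proof (rule integrable_\<mu>_bounded[of _ M])
      show "norm (F x * h x * chr m x) \<le> M" if "x \<in> cell" for x
        using mult_mono[OF bdd[OF that] h1[of x]] order_trans[OF norm_ge_zero bdd[OF that]]
        by (simp add: norm_mult)
    qed measurable
    let ?e = "axis k 1 :: int ^ 'n"
    have "(LINT x|\<mu>. F x * (h x * of_real (?c k x)) * chr m x) = 0" for m
    proof -
      have "F x * (h x * of_real (?c k x)) * chr m x =
          (1 / 2) * (F x * h x * chr m x) + (1 / 4) * (F x * h x * chr (?e + m) x)
          + (1 / 4) * (F x * h x * chr (- ?e + m) x)" for x
        unfolding chr_axis_cos chr_add by (simp add: algebra_simps)
      then have "(LINT x|\<mu>. F x * (h x * of_real (?c k x)) * chr m x) =
          (LINT x|\<mu>. (1 / 2) * (F x * h x * chr m x) + (1 / 4) * (F x * h x * chr (?e + m) x)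
          + (1 / 4) * (F x * h x * chr (- ?e + m) x))" by presburger
      also have "\<dots> = 0"
        using int by (simp add: h0 del: integral_mult_right_zero flip: times_divide_eq_left)
      finally show ?thesis .
    qed
    moreover have "norm (h x * of_real (?c k x)) \<le> 1" for x
    proof -
      have "0 \<le> ?c k x" "?c k x \<le> 1"
        by (rule half_one_plus_cos)+
      then have "norm (h x) * \<bar>?c k x\<bar> \<le> 1 * 1" using h1 by (intro mult_mono) auto
      then show ?thesis unfolding norm_mult norm_of_real by simp
    qed
    moreover have "(\<lambda>x. h x * of_real (?c k x)) \<in> borel_measurable borel"
      by (intro borel_measurable_times h borel_measurable_continuous_onI continuous_intros) auto
    ultimately show ?thesis unfolding Z_def by blast
  qed
  have prods: "Z (\<lambda>x. h x * of_real (\<Prod>k\<in>S. ?c k x))" if "Z h" for h and S :: "'n set"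
    using finite[of S] that
  proof (induction S rule: finite_induct)
    case (insert k S)
    have "(\<lambda>x. h x * of_real (\<Prod>k\<in>insert k S. ?c k x))
        = (\<lambda>x. h x * of_real (\<Prod>k\<in>S. ?c k x) * of_real (?c k x))"
    proof
      fix x
      have "(\<Prod>k\<in>insert k S. ?c k x) = ?c k x * (\<Prod>k\<in>S. ?c k x)"
        by (rule prod.insert) (rule insert(1,2))+
      then show "h x * of_real (\<Prod>k\<in>insert k S. ?c k x)
          = h x * of_real (\<Prod>k\<in>S. ?c k x) * of_real (?c k x)"
        by (simp only: of_real_mult ac_simps)
    qed
    then show ?case using step[OF insert.IH[OF insert.prems], of k] by (simp only:)
  qed simp
  have "Z (\<lambda>x. of_real (bump x ^ N))"
  proof (induction N)
    case 0
    show ?case using orth by (simp add: Z_def)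
  next
    case (Suc N)
    from prods[OF Suc, of UNIV, folded bump_def] show ?case
      by (simp only: power_Suc2 of_real_mult)
  qed
  then have "(LINT x|\<mu>. F x * of_real (bump x ^ N) * chr 0 x) = 0" unfolding Z_def by blast
  then show ?thesis by simp
qed

text \<open>
  Integrating against \<open>bump ^ N\<close> tests \<open>F\<close> in a shrinking neighbourhood of \<open>0\<close>. If \<open>F 0 \<noteq> 0\<close>, then the
  real part \<open>f\<close> of \<open>cnj (F 0) * F\<close> is at least \<open>e / 2\<close> on some ball. On a smaller ball \<open>b\<close> the
  bump exceeds some \<open>r\<close>, while on the rest of the cell outside the first ball it is at most some
  \<open>q < r\<close>, by compactness. The contribution of \<open>b\<close> is at least of order \<open>r ^ N\<close> and that of the rest
  at most of order \<open>q ^ N\<close>, so the integral cannot vanish for large \<open>N\<close>.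
\<close>

lemma eq_0_if_orthogonal:
  fixes F :: "real ^ 'n \<Rightarrow> complex"
  assumes meas [measurable]: "F \<in> borel_measurable borel"
    and bdd: "\<And>x. x \<in> cell \<Longrightarrow> norm (F x) \<le> M"
    and cont: "isCont F 0"
    and orth: "\<And>m. (LINT x|\<mu>. F x * chr m x) = 0"
  shows "F 0 = 0"
proof (rule ccontr)
  assume F0: "F 0 \<noteq> 0"
  define f where "f x = Re (cnj (F 0) * F x)" for x
  define e where "e = (norm (F 0))\<^sup>2"
  have e: "e > 0" using F0 by (simp add: e_def)
  have f0: "f 0 = e"
    unfolding f_def e_def by (metis Re_complex_of_real complex_norm_square mult.commute)
  have f_meas [measurable]: "f \<in> borel_measurable borel" unfolding f_def by measurable
  have cell0: "0 \<in> cell" by (simp add: cell_def)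
  define M' where "M' = norm (F 0) * M"
  have f_bdd: "\<bar>f x\<bar> \<le> M'" if "x \<in> cell" for x
    unfolding f_def M'_def using bdd[OF that] abs_Re_le_cmod[of "cnj (F 0) * F x"]
    by (simp add: norm_mult) (meson dual_order.trans mult_left_mono norm_ge_zero)
  have M': "M' \<ge> 0" using f_bdd[OF cell0] by linarith
  have "isCont f 0" unfolding f_def by (intro isCont_Re isCont_mult continuous_const cont)
  then obtain \<eta>1 where \<eta>1: "\<eta>1 > 0" "\<And>x. norm x < \<eta>1 \<Longrightarrow> \<bar>f x - e\<bar> < e / 2"
    unfolding continuous_at_eps_delta using e f0 by (metis diff_zero half_gt_zero dist_norm real_norm_def)
  obtain r0 where r0: "r0 > 0" "\<And>x. norm x < r0 \<Longrightarrow> x \<in> cell" using cell_nbhd by blast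
  define \<eta> where "\<eta> = min \<eta>1 r0"
  have \<eta>: "\<eta> > 0" "\<And>x. norm x < \<eta> \<Longrightarrow> f x \<ge> e / 2" "\<And>x. norm x < \<eta> \<Longrightarrow> x \<in> cell"
    using \<eta>1 r0 by (auto simp: \<eta>_def) (smt (verit) \<eta>1(2) field_sum_of_halves)
  obtain R where R: "R > 0" "\<And>x. x \<in> cell \<Longrightarrow> norm x \<le> R" using cell_bounded by blast
  \<comment> \<open>A compact set that contains the part of the cell away from \<open>0\<close>, and no lattice point.\<close>
  define S where "S = cball 0 R \<inter> {x. norm x \<ge> \<eta>} \<inter> {x. \<forall>k. \<bar>(B *v x) $ k\<bar> \<le> 1 / 2}"
  have "compact S"
    unfolding S_def
    by (intro compact_Int_closed compact_cball closed_Collect_all closed_Collect_le continuous_intros)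
  obtain q where q: "0 \<le> q" "q < 1" "\<And>x. x \<in> S \<Longrightarrow> bump x \<le> q"
  proof (cases "S = {}")
    case True
    then show thesis by (intro that[of 0]) auto
  next
    case False
    then obtain x0 where x0: "x0 \<in> S" "\<And>x. x \<in> S \<Longrightarrow> bump x \<le> bump x0"
      using continuous_attains_sup[OF \<open>compact S\<close> False continuous_on_bump] by blast
    have "bump x0 < 1" using x0(1) \<eta>(1) by (intro bump_less_1) (auto simp: S_def)
    then show thesis using x0 bump_nonneg by (intro that[of "bump x0"]) auto
  qed
  have q_cell: "bump x \<le> q" if "x \<in> cell" "\<eta> \<le> norm x" for x
  proof (rule q(3))
    have "\<bar>(B *v x) $ k\<bar> \<le> 1 / 2" for k
    proof -
      have "- 1 / 2 \<le> (B *v x) $ k \<and> (B *v x) $ k < 1 / 2" using that(1) by (simp add: cell_def)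
      then show ?thesis by linarith
    qed
    then show "x \<in> S" using that R(2) by (simp add: S_def)
  qed
  define r where "r = (q + 1) / 2"
  have r: "q < r" "r < 1" "r > 0" using q by (auto simp: r_def)
  have "isCont bump 0"
    using continuous_on_bump[of UNIV] by (simp add: continuous_on_eq_continuous_at)
  then obtain \<eta>2 where \<eta>2: "\<eta>2 > 0" "\<And>x. norm x < \<eta>2 \<Longrightarrow> \<bar>bump x - 1\<bar> < 1 - r"
    unfolding continuous_at_eps_delta using r(2) bump_0 by (metis diff_gt_0_iff_gt diff_zero dist_norm real_norm_def)
  define b where "b = ball (0 :: real ^ 'n) (min \<eta> \<eta>2)"
  have b_cell: "b \<subseteq> cell" using \<eta>(3) by (auto simp: b_def)
  have b_meas: "b \<in> sets \<mu>" "b \<in> sets borel"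
    using b_cell by (auto simp: \<mu>_def sets_restrict_space_iff b_def)
  define v where "v = measure \<mu> b"
  have v: "v > 0"
  proof -
    have "measure \<mu> b = measure lborel b"
      unfolding \<mu>_def using b_cell by (intro measure_restrict_space) auto
    also have "\<dots> > 0"
      unfolding b_def using \<eta>(1) \<eta>2(1) content_ball_pos[of "min \<eta> \<eta>2" "0::real^'n"]
      by (simp add: measure_completion)
    finally show ?thesis by (simp add: v_def)
  qed
  have ineq: "e / 2 * v \<le> M' * vol * (q / r) ^ N" for N
  proof -
    have bump1: "bump x \<le> 1" for x
      unfolding bump_def
      by (intro prod_le_1 conjI half_one_plus_cos)
    have bN: "\<bar>bump x ^ N\<bar> \<le> 1" for x
      using bump1[of x] bump_nonneg[of x] by (simp add: power_le_one)
    have bump_meas: "bump \<in> borel_measurable borel"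
      by (intro borel_measurable_continuous_onI continuous_intros)
    have int_f: "integrable \<mu> (\<lambda>x. f x * bump x ^ N)"
    proof (rule integrable_\<mu>_bounded[of _ M'])
      show "(\<lambda>x. f x * bump x ^ N) \<in> borel_measurable borel" using bump_meas by measurable
      show "norm (f x * bump x ^ N) \<le> M'" if "x \<in> cell" for x
        using mult_mono[OF f_bdd[OF that] bN[of x]] M' by (simp add: abs_mult)
    qed
    have int_F: "integrable \<mu> (\<lambda>x. F x * of_real (bump x ^ N))"
    proof (rule integrable_\<mu>_bounded[of _ M])
      show "(\<lambda>x. F x * of_real (bump x ^ N)) \<in> borel_measurable borel" using bump_meas by measurable
      show "norm (F x * of_real (bump x ^ N)) \<le> M" if "x \<in> cell" for x
        using mult_mono[OF bdd[OF that] bN[of x]] order_trans[OF norm_ge_zero bdd[OF that]]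
        unfolding norm_mult norm_of_real by simp
    qed
    have "(LINT x|\<mu>. f x * bump x ^ N) = (LINT x|\<mu>. Re (cnj (F 0) * (F x * of_real (bump x ^ N))))"
      by (rule Bochner_Integration.integral_cong) (simp_all add: f_def algebra_simps)
    also have "\<dots> = Re (cnj (F 0) * (LINT x|\<mu>. F x * of_real (bump x ^ N)))"
      using int_F by (subst integral_Re) (auto simp del: of_real_power)
    also have "\<dots> = 0"
      using bump_power_orthogonal[OF meas bdd orth] by simp
    finally have zero: "(LINT x|\<mu>. f x * bump x ^ N) = 0" .
    have "(LINT x|\<mu>. e / 2 * r ^ N * indicator b x - M' * q ^ N) \<le> (LINT x|\<mu>. f x * bump x ^ N)"
    proof (rule integral_mono[OF _ int_f])
      show "integrable \<mu> (\<lambda>x. e / 2 * r ^ N * indicator b x - M' * q ^ N)"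
        using b_meas by (intro Bochner_Integration.integrable_diff integrable_mult_right integrable_real_indicator)
          (auto simp: \<mu>.emeasure_eq_measure)
      fix x assume "x \<in> space \<mu>"
      then have x: "x \<in> cell" by simp
      have Mq: "0 \<le> M' * q ^ N" using M' q by simp
      show "e / 2 * r ^ N * indicator b x - M' * q ^ N \<le> f x * bump x ^ N"
      proof (cases "norm x < \<eta>")
        case True
        show ?thesis
        proof (cases "x \<in> b")
          case xb: True
          then have "r \<le> bump x" using \<eta>2(2)[of x] by (simp add: b_def)
          then have "e / 2 * r ^ N \<le> f x * bump x ^ N"
            using \<eta>(2)[OF True] r(3) e by (intro mult_mono power_mono) auto
          with xb Mq show ?thesis by simp
        next
          case False
          have "0 \<le> f x * bump x ^ N"
            using \<eta>(2)[OF True] e bump_nonneg[of x] by (intro mult_nonneg_nonneg) auto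
          with False Mq show ?thesis by simp
        qed
      next
        case False
        have "\<bar>f x * bump x ^ N\<bar> \<le> M' * q ^ N"
          unfolding abs_mult using f_bdd[OF x] q_cell[OF x] False bump_nonneg[of x] M'
          by (intro mult_mono) (auto intro: power_mono simp: power_abs)
        moreover have "x \<notin> b" using False by (simp add: b_def)
        ultimately show ?thesis by simp
      qed
    qed
    also have "(LINT x|\<mu>. e / 2 * r ^ N * indicator b x - M' * q ^ N) = e / 2 * r ^ N * v - M' * q ^ N * vol"
      using b_meas b_cell
      by (subst Bochner_Integration.integral_diff)
        (auto simp: measure_\<mu> v_def Int_absorb2 \<mu>.emeasure_eq_measure intro!: integrable_mult_right integrable_real_indicator)
    finally have "e / 2 * v * r ^ N \<le> M' * vol * q ^ N" unfolding zero by (simp add: algebra_simps)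
    then show ?thesis using r(3) by (simp add: power_divide field_simps)
  qed
  have "(\<lambda>N. M' * vol * (q / r) ^ N) \<longlonglongrightarrow> M' * vol * 0"
    by (intro tendsto_intros LIMSEQ_power_zero) (use q r in auto)
  then have "e / 2 * v \<le> M' * vol * 0"
    by (rule LIMSEQ_le_const) (use ineq in blast)
  with e v show False by (simp add: mult_le_0_iff)
qed

end

section \<open>Poisson summation and Fourier inversion\<close>

context lattice
begin

lemma continuous_on_periodization:
  fixes g :: "real ^ 'n \<Rightarrow> complex"
  assumes \<delta>: "\<delta> > 0" and g: "\<And>x. norm (g x) \<le> C * decay \<delta> x" and cont: "continuous_on UNIV g"
  shows "continuous_on (cball 0 R) (\<lambda>x. \<Sum>\<^sub>\<infinity>m. g (x + node A m))"
proof -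
  obtain W where W: "W summable_on UNIV" "\<And>x m. norm x \<le> R \<Longrightarrow> norm (g (x + node A m)) \<le> W m"
    using summable_majorant[OF \<delta> g] by blast
  have "uniform_limit (cball 0 R) (\<lambda>M x. \<Sum>m\<in>M. g (x + node A m))
      (\<lambda>x. \<Sum>\<^sub>\<infinity>m. g (x + node A m)) (finite_subsets_at_top UNIV)"
    by (rule Weierstrass_m_test_general[OF _ W(1)]) (use W(2) in auto)
  then show ?thesis
    by (rule uniform_limit_theorem[rotated])
      (auto intro!: always_eventually continuous_intros continuous_on_compose2[OF cont])
qed

lemma continuous_on_chr_series:
  assumes b: "(\<lambda>m. norm (b m)) summable_on UNIV"
  shows "continuous_on S (\<lambda>x. \<Sum>\<^sub>\<infinity>m. b m * chr m x)"
proof -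
  have "uniform_limit S (\<lambda>M x. \<Sum>m\<in>M. b m * chr m x)
      (\<lambda>x. \<Sum>\<^sub>\<infinity>m. b m * chr m x) (finite_subsets_at_top UNIV)"
    by (rule Weierstrass_m_test_general[OF _ b]) (simp add: norm_mult)
  then show ?thesis
    by (rule uniform_limit_theorem[rotated]) (auto intro!: always_eventually continuous_intros)
qed

text \<open>
  The periodization of \<open>g\<close> and the trigonometric series with the coefficients of \<open>g\<close> are continuous
  periodic functions with the same Fourier coefficients. Their difference vanishes at \<open>0\<close>, which is the
  assertion.
\<close>

theorem poisson_summation:
  fixes g :: "real ^ 'n \<Rightarrow> complex"
  assumes \<delta>: "\<delta> > 0" and g: "\<And>x. norm (g x) \<le> C * decay \<delta> x" and cont: "continuous_on UNIV g"
    and sm: "(\<lambda>m. norm (LINT x|lborel. g x * chr (- m) x)) summable_on UNIV"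
  shows "of_real vol * (\<Sum>\<^sub>\<infinity>m. g (node A m)) = (\<Sum>\<^sub>\<infinity>m. LINT x|lborel. g x * chr (- m) x)"
proof -
  define \<gamma> where "\<gamma> m = (LINT x|lborel. g x * chr (- m) x)" for m
  define b where "b m = \<gamma> m / of_real vol" for m
  have b: "(\<lambda>m. norm (b m)) summable_on UNIV"
    using summable_on_cmult_left[OF sm, of "inverse vol"] vol_pos
    by (simp add: b_def \<gamma>_def divide_inverse norm_mult norm_inverse)
  define P where "P x = (\<Sum>\<^sub>\<infinity>m. g (x + node A m))" for x
  define T where "T x = (\<Sum>\<^sub>\<infinity>m. b m * chr m x)" for x
  have contP: "continuous_on UNIV P"
  proof -
    have "isCont P x" for x
    proof (rule continuous_on_interior)
      show "continuous_on (cball 0 (norm x + 1)) P"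
        unfolding P_def by (rule continuous_on_periodization[OF \<delta> g cont])
      show "x \<in> interior (cball 0 (norm x + 1))" by simp
    qed
    then show ?thesis by (simp add: continuous_on_eq_continuous_at)
  qed
  have contT: "continuous_on UNIV T" unfolding T_def by (rule continuous_on_chr_series[OF b])
  have meas [measurable]: "P \<in> borel_measurable borel" "T \<in> borel_measurable borel" "g \<in> borel_measurable borel"
    using contP contT cont by (auto intro: borel_measurable_continuous_onI)
  obtain R where R: "R > 0" "\<And>x. x \<in> cell \<Longrightarrow> norm x \<le> R" using cell_bounded by blast
  have bdd: "\<exists>M. \<forall>x\<in>cell. norm (F x) \<le> M" if "continuous_on UNIV F" for F :: "real ^ 'n \<Rightarrow> complex"
  proof -
    have "compact (F ` cball 0 R)"
      by (intro compact_continuous_image continuous_on_subset[OF that]) auto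
    then obtain M where "\<forall>y\<in>F ` cball 0 R. norm y \<le> M"
      using compact_imp_bounded bounded_iff by metis
    with R(2) show ?thesis by (intro exI[of _ M]) auto
  qed
  have int: "integrable \<mu> (\<lambda>x. F x * chr j x)" if F: "continuous_on UNIV F" for F and j
  proof -
    obtain M where M: "\<forall>x\<in>cell. norm (F x) \<le> M" using bdd[OF F] by blast
    show ?thesis
      by (rule integrable_\<mu>_bounded[of _ M])
        (use M F in \<open>auto simp: norm_mult intro!: borel_measurable_continuous_onI continuous_intros\<close>)
  qed
  have orth: "(LINT x|\<mu>. (P x - T x) * chr j x) = 0" for j
  proof -
    have "\<gamma> (- j) = (LINT x|\<mu>. (\<Sum>\<^sub>\<infinity>m. g (x + node A m) * chr j (x + node A m)))"
    proof -
      have "(LINT x|lborel. g x * chr j x) = (LINT x|\<mu>. (\<Sum>\<^sub>\<infinity>m. g (x + node A m) * chr j (x + node A m)))"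
        by (rule unfolding_integral(2)[OF _ \<delta>]) (use g in \<open>auto simp: norm_mult\<close>)
      then show ?thesis by (simp add: \<gamma>_def)
    qed
    also have "\<dots> = (LINT x|\<mu>. P x * chr j x)"
      by (simp add: P_def infsum_cmult_left')
    finally have 1: "(LINT x|\<mu>. P x * chr j x) = \<gamma> (- j)" ..
    have 2: "(LINT x|\<mu>. T x * chr j x) = \<gamma> (- j)"
      using integral_chr_series[OF b, of "- j"] vol_pos by (simp add: T_def b_def)
    have "(LINT x|\<mu>. (P x - T x) * chr j x) = (LINT x|\<mu>. P x * chr j x) - (LINT x|\<mu>. T x * chr j x)"
      unfolding left_diff_distrib using contP contT by (intro Bochner_Integration.integral_diff int)
    then show ?thesis unfolding 1 2 by simp
  qed
  have contPT: "continuous_on UNIV (\<lambda>x. P x - T x)" by (intro continuous_intros contP contT)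
  obtain M where M: "\<And>x. x \<in> cell \<Longrightarrow> norm (P x - T x) \<le> M" using bdd[OF contPT] by blast
  have "P 0 - T 0 = 0"
    by (rule eq_0_if_orthogonal[OF _ M _ orth])
      (use contPT in \<open>auto simp: continuous_on_eq_continuous_at intro: borel_measurable_diff\<close>)
  then have "(\<Sum>\<^sub>\<infinity>m. g (node A m)) = (\<Sum>\<^sub>\<infinity>m. \<gamma> m / of_real vol)"
    by (simp add: P_def T_def b_def)
  also have "\<dots> = (\<Sum>\<^sub>\<infinity>m. \<gamma> m) / of_real vol"
    by (simp add: divide_inverse infsum_cmult_left')
  finally show ?thesis using vol_pos by (simp add: \<gamma>_def)
qed

end

lemma inner_transpose: "x \<bullet> (transpose M *v y) = (M *v x) \<bullet> y" for M :: "real ^ 'n ^ 'n"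
  by (simp add: dot_lmul_matrix[symmetric] transpose_matrix_vector inner_commute)

lemma (in lattice) dual_lattice:
  "lattice ((2 * pi) *\<^sub>R transpose B) ((1 / (2 * pi)) *\<^sub>R transpose A)"
proof
  have "transpose B ** transpose A = mat 1"
    by (simp add: AB flip: matrix_transpose_mul)
  then show "((2 * pi) *\<^sub>R transpose B) ** ((1 / (2 * pi)) *\<^sub>R transpose A) = mat 1"
    by (simp add: matrix_scalar_ac flip: scalar_matrix_assoc)
qed

text \<open>
  No assumption is added to those of a lattice. The locale is separate because declaring the dual
  lattice as a sublocale of \<open>lattice\<close> itself would generate the dual of the dual, and so on.
\<close>

locale dual_pair = lattice A B for A B :: "real ^ 'n ^ 'n"
begin

sublocale dual: lattice "(2 * pi) *\<^sub>R transpose B" "(1 / (2 * pi)) *\<^sub>R transpose A"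
  by (rule dual_lattice)

abbreviation dnode :: "int ^ 'n \<Rightarrow> real ^ 'n" where
  "dnode \<equiv> node ((2 * pi) *\<^sub>R transpose B)"

lemma dnode_eq: "dnode m = (2 * pi) *\<^sub>R (transpose B *v real_vec m)"
  by (simp only: node_def scaleR_matrix_vector_assoc)

lemma chr_eq: "chr m x = cis (dnode m \<bullet> x)"
  by (simp add: chr_def dnode_eq inner_transpose inner_commute[of _ x] inner_commute[of "B *v x"]
      del: transpose_matrix_vector)

lemma dual_chr_eq: "dual.chr m z = cis (node A m \<bullet> z)"
proof -
  have "real_vec m \<bullet> (((1 / (2 * pi)) *\<^sub>R transpose A) *v z) = (node A m \<bullet> z) / (2 * pi)"
    by (simp add: node_def inner_transpose del: transpose_matrix_vector flip: scaleR_matrix_vector_assoc)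
  then show ?thesis unfolding dual.chr_def by simp
qed

end

lemma fourier_cis: "fourier f y = (LINT x|lborel. cis (- (x \<bullet> y)) * f x)"
  by (simp add: fourier_def cis_conv_exp)

lemma borel_measurable_cis_inner [measurable]:
  "(\<lambda>x. cis (x \<bullet> y)) \<in> borel_measurable borel" for y :: "real ^ 'n"
  by (intro borel_measurable_continuous_onI continuous_intros)

lemma borel_measurable_fourier:
  fixes f :: "real ^ 'n \<Rightarrow> complex"
  assumes [measurable]: "f \<in> borel_measurable borel"
  shows "fourier f \<in> borel_measurable borel"
proof -
  have [measurable]: "(\<lambda>t :: real. cis t) \<in> borel_measurable borel"
    by (intro borel_measurable_continuous_onI continuous_intros)
  have "(\<lambda>y. LINT x|lborel. cis (- (x \<bullet> y)) * f x) \<in> borel_measurable borel"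
    by measurable
  then show ?thesis unfolding fourier_cis[abs_def] .
qed

context dual_pair
begin

text \<open>
  Poisson summation for the translated and modulated function \<open>K(a + x) exp(-i \<langle>x, z\<rangle>)\<close>. Modulation
  shifts the Fourier transform by \<open>z\<close>, so that the whole periodization appears and not only its value at
  \<open>0\<close>; translation prepares the proof of the inversion formula.
\<close>

theorem poisson_fourier:
  fixes K :: "real ^ 'n \<Rightarrow> real"
  assumes \<delta>: "\<delta> > 0" and cont: "continuous_on UNIV K"
    and K: "\<And>x. \<bar>K x\<bar> \<le> C * decay \<delta> x"
    and FK: "\<And>x. norm (fourier (\<lambda>t. complex_of_real (K t)) x) \<le> C * decay \<delta> x"
  shows "of_real vol * (\<Sum>\<^sub>\<infinity>m. of_real (K (a + node A m)) * cis (- (node A m \<bullet> z)))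
    = (\<Sum>\<^sub>\<infinity>m. cis (a \<bullet> (z + dnode m)) * fourier (\<lambda>t. complex_of_real (K t)) (z + dnode m))"
proof -
  let ?F = "fourier (\<lambda>t. complex_of_real (K t))"
  have [measurable]: "K \<in> borel_measurable borel" using cont by (rule borel_measurable_continuous_onI)
  define g where "g x = complex_of_real (K (a + x)) * cis (- (x \<bullet> z))" for x
  define L where "L = (1 + norm a) powr (real CARD('n) + \<delta>)"
  have g: "norm (g x) \<le> (C * L) * decay \<delta> x" for x
  proof -
    have "norm (g x) = \<bar>K (x + a)\<bar>" by (simp add: g_def norm_mult add.commute)
    also have "\<dots> \<le> C * decay \<delta> (x + a)" by (rule K)
    also have "\<dots> \<le> C * (L * decay \<delta> x)"
      using decay_add[OF \<delta>, of x a, folded L_def] decay_bound_nonneg[of ?F C \<delta>, OF FK] by (intro mult_left_mono)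
    finally show ?thesis by simp
  qed
  have contg: "continuous_on UNIV g"
    unfolding g_def by (intro continuous_intros continuous_on_compose2[OF cont]) auto
  have coef: "(LINT x|lborel. g x * chr (- m) x) = cis (a \<bullet> (z + dnode m)) * ?F (z + dnode m)" for m
  proof -
    let ?y = "z + dnode m"
    define h where "h x = cis (a \<bullet> ?y) * (cis (- (x \<bullet> ?y)) * of_real (K x))" for x
    have "g x * chr (- m) x = h (x + a)" for x
    proof -
      have "cis (- (x \<bullet> z)) * chr (- m) x = cis (- (x \<bullet> ?y))"
        unfolding chr_uminus chr_eq cis_cnj cis_mult by (simp add: inner_add_right inner_commute)
      also have "\<dots> = cis (a \<bullet> ?y) * cis (- ((x + a) \<bullet> ?y))"
        by (simp add: cis_mult inner_add_left)
      finally show ?thesis by (simp add: g_def h_def add.commute mult.assoc mult.left_commute)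
    qed
    then have "(LINT x|lborel. g x * chr (- m) x) = (LINT x|lborel. h (x + a))" by simp
    also have "\<dots> = (LINT x|lborel. h x)"
      by (rule integral_translate(1)) (unfold h_def inner_minus_left[symmetric], measurable)
    also have "\<dots> = cis (a \<bullet> ?y) * ?F ?y" by (simp add: h_def fourier_cis)
    finally show ?thesis .
  qed
  have sm: "(\<lambda>m. norm (LINT x|lborel. g x * chr (- m) x)) summable_on UNIV"
    unfolding coef using dual.summable_on_translates[OF \<delta> FK, of z] by (simp add: norm_mult)
  show ?thesis
    using poisson_summation[OF \<delta> g contg sm] unfolding coef by (simp add: g_def)
qed

text \<open>
  Integrate \<open>poisson_fourier\<close> over \<open>z\<close> in a cell of the dual lattice. Against the samples of \<open>K\<close> stand
  characters of the dual lattice, and only the trivial one has a nonzero integral; on the other side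
  the integral over the cell unfolds to an integral over the whole space.
\<close>

theorem fourier_inversion_vol:
  fixes K :: "real ^ 'n \<Rightarrow> real"
  assumes \<delta>: "\<delta> > 0" and cont: "continuous_on UNIV K"
    and K: "\<And>x. \<bar>K x\<bar> \<le> C * decay \<delta> x"
    and FK: "\<And>x. norm (fourier (\<lambda>t. complex_of_real (K t)) x) \<le> C * decay \<delta> x"
  shows "(LINT y|lborel. cis (a \<bullet> y) * fourier (\<lambda>t. complex_of_real (K t)) y)
    = of_real (vol * dual.vol * K a)"
proof -
  let ?F = "fourier (\<lambda>t. complex_of_real (K t))"
  have K_meas [measurable]: "K \<in> borel_measurable borel" using cont by (rule borel_measurable_continuous_onI)
  have [measurable]: "?F \<in> borel_measurable borel" by (rule borel_measurable_fourier) measurable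
  define b where "b m = complex_of_real (K (a - node A m))" for m
  have b: "(\<lambda>m. norm (b m)) summable_on UNIV"
  proof -
    have "(\<lambda>m. norm (K (a + node A m))) summable_on UNIV"
      by (rule summable_on_translates[OF \<delta>]) (use K in auto)
    then show ?thesis
      by (subst (asm) summable_on_reindex_bij_betw[of uminus UNIV UNIV, symmetric])
        (auto simp: b_def bij_betw_def inj_def intro: surjI[of _ uminus])
  qed
  have "(LINT y|lborel. cis (a \<bullet> y) * ?F y)
      = (LINT z|dual.\<mu>. (\<Sum>\<^sub>\<infinity>m. cis (a \<bullet> (z + dnode m)) * ?F (z + dnode m)))"
    by (rule dual.unfolding_integral(2)[OF _ \<delta>])
      (use FK in \<open>auto simp: norm_mult inner_commute[of a]\<close>)
  also have "\<dots> = (LINT z|dual.\<mu>. of_real vol * (\<Sum>\<^sub>\<infinity>m. of_real (K (a + node A m)) * cis (- (node A m \<bullet> z))))"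
    unfolding poisson_fourier[OF \<delta> cont K FK] ..
  also have "\<dots> = of_real vol * (LINT z|dual.\<mu>. (\<Sum>\<^sub>\<infinity>m. b m * dual.chr m z))"
  proof -
    have "(\<Sum>\<^sub>\<infinity>m. of_real (K (a + node A m)) * cis (- (node A m \<bullet> z))) = (\<Sum>\<^sub>\<infinity>m. b m * dual.chr m z)" for z
      by (rule infsum_reindex_bij_witness[of _ uminus uminus]) (auto simp: b_def dual_chr_eq)
    then show ?thesis by simp
  qed
  also have "(LINT z|dual.\<mu>. (\<Sum>\<^sub>\<infinity>m. b m * dual.chr m z)) = b 0 * of_real dual.vol"
    using dual.integral_chr_series[OF b, of 0] by simp
  finally show ?thesis by (simp add: b_def)
qed

end

lemma lattice_mat: "c \<noteq> 0 \<Longrightarrow> lattice (mat c :: real ^ 'n ^ 'n) (mat (1 / c))"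
  by unfold_locales (simp add: matrix_matrix_mult_def mat_def vec_eq_iff if_distrib[of "\<lambda>x. x * _"] cong: if_cong)

lemma vol_mat:
  assumes "c > 0"
  shows "lattice.vol (mat (1 / c) :: real ^ 'n ^ 'n) = c ^ CARD('n)"
proof -
  interpret lattice "mat c :: real ^ 'n ^ 'n" "mat (1 / c)" using assms by (intro lattice_mat) auto
  let ?u = "(\<chi> k. c / 2) :: real ^ 'n"
  have mat_v: "(mat (1 / c) *v x) $ k = x $ k / c" for x :: "real ^ 'n" and k
    by (simp add: matrix_vector_mult_def mat_def if_distrib[of "\<lambda>x. x * _"] cong: if_cong)
  have cell_iff: "x \<in> cell \<longleftrightarrow> (\<forall>k. - c / 2 \<le> x $ k \<and> x $ k < c / 2)" for x
    unfolding cell_def mat_v using assms by (simp add: field_simps)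
  have sub: "box (- ?u) ?u \<subseteq> cell" "cell \<subseteq> cbox (- ?u) ?u"
    by (simp_all add: subset_eq cell_iff mem_box_cart less_imp_le)
  have ne: "cbox (- ?u) ?u \<noteq> {}"
  proof -
    have "0 \<in> cbox (- ?u) ?u" using assms by (simp add: mem_box_cart)
    then show ?thesis by blast
  qed
  have "measure lborel (cbox (- ?u) ?u) = c ^ CARD('n)"
    using ne by (simp add: content_cbox_cart)
  moreover have "measure lborel (box (- ?u) ?u) = measure lborel (cbox (- ?u) ?u)"
    by (simp add: measure_def emeasure_lborel_box_eq emeasure_lborel_cbox_eq)
  moreover have "measure lborel (box (- ?u) ?u) \<le> vol" unfolding vol_def
    using sub(1) emeasure_cell_finite by (intro measure_mono_fmeasurable) (auto simp: fmeasurable_def)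
  moreover have "vol \<le> measure lborel (cbox (- ?u) ?u)" unfolding vol_def
    using sub(2) by (intro measure_mono_fmeasurable) auto
  ultimately show ?thesis by simp
qed

text \<open>
  The inversion formula does not depend on a lattice, so it suffices to know the volumes of the cells of
  one dual pair. For the integer lattice they are \<open>1\<close> and \<open>(2 pi)^n\<close>.
\<close>

theorem fourier_inversion:
  fixes K :: "real ^ 'n \<Rightarrow> real"
  assumes "\<delta> > 0" and "continuous_on UNIV K"
    and "\<And>x. \<bar>K x\<bar> \<le> C * decay \<delta> x"
    and "\<And>x. norm (fourier (\<lambda>t. complex_of_real (K t)) x) \<le> C * decay \<delta> x"
  shows "fourier_inv (fourier (\<lambda>t. complex_of_real (K t))) a = of_real (K a)"
proof -
  interpret dual_pair "mat 1 :: real ^ 'n ^ 'n" "mat 1"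
    using lattice_mat[of 1] by (simp add: dual_pair_def)
  have "vol = 1" using vol_mat[of 1, where 'n = 'n] by simp
  moreover have "dual.vol = (2 * pi) ^ CARD('n)"
  proof -
    have "(1 / (2 * pi)) *\<^sub>R transpose (mat 1 :: real ^ 'n ^ 'n) = mat (1 / (2 * pi))"
      by (simp add: vec_eq_iff transpose_def mat_def)
    then show ?thesis using vol_mat[of "2 * pi", where 'n = 'n] by simp
  qed
  ultimately show ?thesis
    using fourier_inversion_vol[OF assms, of a] by (simp add: fourier_inv_def cis_conv_exp)
qed

section \<open>Convolution inverses\<close>

lemma infsum_complex_of_real:
  "f summable_on S \<Longrightarrow> (\<Sum>\<^sub>\<infinity>x\<in>S. complex_of_real (f x)) = of_real (infsum f S)"
  by (intro infsumI has_sum_of_real has_sum_infsum)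

lemma bij_shift: "bij (\<lambda>t. t - s)" for s :: "'i::ab_group_add"
  by (rule bij_betw_byWitness[of _ "\<lambda>t. t + s"]) auto

lemma bij_reflect: "bij (\<lambda>t. s - t)" for s :: "'i::ab_group_add"
  by (rule bij_betw_byWitness[of _ "\<lambda>t. s - t"]) auto

lemma abs_summable_on_convolution:
  fixes f g :: "'i::ab_group_add \<Rightarrow> 'b::real_normed_field"
  assumes f: "f abs_summable_on UNIV" and g: "g abs_summable_on UNIV"
  shows "(\<lambda>(s, t). f s * g (t - s)) abs_summable_on UNIV \<times> UNIV"
proof (subst Infinite_Sum.abs_summable_on_Sigma_iff, intro conjI ballI)
  have "(\<Sum>\<^sub>\<infinity>t. norm (g (t - s))) = (\<Sum>\<^sub>\<infinity>t. norm (g t))" for s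
    by (rule infsum_reindex_bij_betw[OF bij_shift])
  then have eq: "(\<Sum>\<^sub>\<infinity>t. norm (f s * g (t - s))) = norm (f s) * (\<Sum>\<^sub>\<infinity>t. norm (g t))" for s
    by (simp add: norm_mult infsum_cmult_right')
  show "(\<lambda>t. case (s, t) of (s, t) \<Rightarrow> f s * g (t - s)) abs_summable_on UNIV" for s
    using summable_on_reindex_bij_betw[OF bij_shift[of s], of "\<lambda>t. norm (g t)"] g
    by (simp add: norm_mult summable_on_cmult_right)
  have "(\<lambda>s. norm (f s) * (\<Sum>\<^sub>\<infinity>t. norm (g t))) summable_on UNIV"
    using f by (rule summable_on_cmult_left)
  then show "(\<lambda>s. \<Sum>\<^sub>\<infinity>t. norm (case (s, t) of (s, t) \<Rightarrow> f s * g (t - s))) abs_summable_on UNIV"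
    by (simp add: eq abs_mult infsum_nonneg)
qed

text \<open>
  The usual argument \<open>c = (d * k) * c = d * (k * c) = d\<close> for inverses in a convolution algebra. Here \<open>c\<close> is
  only bounded, which still suffices for Fubini because \<open>d\<close> and \<open>k\<close> are summable.
\<close>

lemma convolution_inverse_unique:
  fixes c d k :: "'i::ab_group_add \<Rightarrow> real"
  assumes k: "k abs_summable_on UNIV" and d: "d abs_summable_on UNIV" and c: "\<And>s. \<bar>c s\<bar> \<le> M"
    and dk: "\<And>t. (\<Sum>\<^sub>\<infinity>s. d s * k (t - s)) = (if t = 0 then 1 else 0)"
    and ck: "\<And>t. (\<Sum>\<^sub>\<infinity>s. c s * k (t - s)) = (if t = 0 then 1 else 0)"
  shows "c = d"
proof
  fix r
  have M: "M \<ge> 0" using c[of 0] by linarith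
  have d': "(\<lambda>t. d (r - t)) abs_summable_on UNIV"
    using summable_on_reindex_bij_betw[OF bij_reflect[of r], of "\<lambda>t. norm (d t)"] d by simp
  have k': "(\<lambda>u. k (- u)) abs_summable_on UNIV"
    using summable_on_reindex_bij_betw[OF bij_reflect[of 0], of "\<lambda>t. norm (k t)"] k by simp
  have "(\<lambda>(t, s). d (r - t) * k (- (s - t))) abs_summable_on UNIV \<times> UNIV"
    by (rule abs_summable_on_convolution[OF d' k'])
  then have "(\<lambda>p. M * norm (case p of (t, s) \<Rightarrow> d (r - t) * k (- (s - t)))) summable_on UNIV \<times> UNIV"
    by (rule summable_on_cmult_right)
  then have "(\<lambda>(t, s). d (r - t) * (c s * k (t - s))) abs_summable_on UNIV \<times> UNIV"
  proof (rule summable_on_comparison_test)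
    fix p :: "'i \<times> 'i"
    obtain t s where p: "p = (t, s)" by force
    have "\<bar>c s\<bar> * \<bar>d (r - t) * k (t - s)\<bar> \<le> M * \<bar>d (r - t) * k (t - s)\<bar>"
      by (intro mult_right_mono c) simp
    then show "norm (case p of (t, s) \<Rightarrow> d (r - t) * (c s * k (t - s)))
        \<le> M * norm (case p of (t, s) \<Rightarrow> d (r - t) * k (- (s - t)))"
      by (simp add: p abs_mult mult_ac)
  qed auto
  then have "(\<lambda>(t, s). d (r - t) * (c s * k (t - s))) summable_on UNIV \<times> UNIV"
    by (rule abs_summable_summable)
  then have swap: "(\<Sum>\<^sub>\<infinity>t. \<Sum>\<^sub>\<infinity>s. d (r - t) * (c s * k (t - s))) = (\<Sum>\<^sub>\<infinity>s. \<Sum>\<^sub>\<infinity>t. d (r - t) * (c s * k (t - s)))"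
    by (rule infsum_swap_banach)
  have rows: "(\<Sum>\<^sub>\<infinity>s. d (r - t) * (c s * k (t - s))) = (if t = 0 then d r else 0)" for t
    by (simp add: infsum_cmult_right' ck)
  have cols: "(\<Sum>\<^sub>\<infinity>t. d (r - t) * (c s * k (t - s))) = (if s = r then c r else 0)" for s
  proof -
    have "(\<Sum>\<^sub>\<infinity>t. d (r - t) * (c s * k (t - s))) = c s * (\<Sum>\<^sub>\<infinity>t. d (r - t) * k (t - s))"
      by (simp add: mult_ac flip: infsum_cmult_right')
    also have "(\<Sum>\<^sub>\<infinity>t. d (r - t) * k (t - s)) = (\<Sum>\<^sub>\<infinity>u. d u * k (r - s - u))"
      using infsum_reindex_bij_betw[OF bij_reflect[of r], of "\<lambda>u. d u * k (r - s - u)"]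
      by (simp add: algebra_simps)
    finally show ?thesis by (auto simp: dk)
  qed
  have row_sum: "(\<Sum>\<^sub>\<infinity>t. if t = 0 then d r else 0) = d r"
    by (rule infsumI, rule has_sum_finite_neutralI[of "{0}"]) auto
  have col_sum: "(\<Sum>\<^sub>\<infinity>s. if s = r then c r else 0) = c r"
    by (rule infsumI, rule has_sum_finite_neutralI[of "{r}"]) auto
  show "c r = d r"
    using swap unfolding rows cols row_sum col_sum by (rule sym)
qed

section \<open>Fundamental splines\<close>

locale decaying_kernel = dual_pair A B for A B :: "real ^ 'n ^ 'n" +
  fixes K :: "real ^ 'n \<Rightarrow> real" and C \<delta> :: real
  assumes \<delta>: "\<delta> > 0" and cont: "continuous_on UNIV K"
    and K_decay: "\<And>x. \<bar>K x\<bar> \<le> C * decay \<delta> x"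
    and FK_decay: "\<And>x. norm (fourier (\<lambda>t. complex_of_real (K t)) x) \<le> C * decay \<delta> x"
begin

abbreviation FK :: "real ^ 'n \<Rightarrow> complex" where
  "FK \<equiv> fourier (\<lambda>t. complex_of_real (K t))"

definition k :: "int ^ 'n \<Rightarrow> real" where
  "k m = K (node A m)"

text \<open>
  The Fourier series with the samples of \<open>K\<close> at the nodes as coefficients. It is the denominator of the
  formula for the fundamental spline.
\<close>

definition symbol :: "real ^ 'n \<Rightarrow> complex" where
  "symbol z = (\<Sum>\<^sub>\<infinity>m. of_real (k m) * dual.chr (- m) z)"

lemma K_meas [measurable]: "K \<in> borel_measurable borel"
  using cont by (rule borel_measurable_continuous_onI)

lemma FK_meas [measurable]: "FK \<in> borel_measurable borel"
  by (rule borel_measurable_fourier) measurable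

lemma C_nonneg: "C \<ge> 0"
  by (rule decay_bound_nonneg[OF FK_decay])

lemma K_bounded: "\<bar>K x\<bar> \<le> C"
  using K_decay[of x] mult_left_mono[OF decay_le_1[OF \<delta>, of x] C_nonneg] by simp

lemma k_summable: "k abs_summable_on UNIV"
  using summable_on_translates[of \<delta> K C 0] \<delta> K_decay by (simp add: k_def)

lemma integrable_K: "integrable lborel K"
proof -
  have "integrable lborel (\<lambda>x. complex_of_real (K x))"
    by (rule unfolding_integral(1)[OF _ \<delta>]) (use K_decay in auto)
  then show ?thesis by (simp add: complex_of_real_integrable_eq)
qed

lemma integrable_FK: "integrable lborel FK"
  by (rule unfolding_integral(1)[OF FK_meas \<delta> FK_decay])

lemma vol_symbol: "of_real vol * symbol z = (\<Sum>\<^sub>\<infinity>m. FK (z + dnode m))"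
  using poisson_fourier[OF \<delta> cont K_decay FK_decay, of 0 z]
  by (simp add: symbol_def k_def dual_chr_eq)

lemma symbol_uminus: "symbol (- z) = cnj (symbol z)"
proof -
  have "cnj (symbol z) = (\<Sum>\<^sub>\<infinity>m. cnj (of_real (k m) * dual.chr (- m) z))"
    unfolding symbol_def by (rule infsum_cnj[symmetric])
  then show ?thesis by (simp add: symbol_def dual.chr_uminus_right)
qed

text \<open>
  The symbol at \<open>-z\<close> is the conjugate of the symbol at \<open>z\<close>, so the conjugates of the coefficients
  represent the same function. Averaging the two series yields real coefficients.
\<close>

lemma real_inverse_coefficients:
  assumes \<alpha>: "\<And>z. ((\<lambda>s. \<alpha> s * dual.chr (- s) z) has_sum inverse (symbol z)) UNIV"
  obtains d :: "int ^ 'n \<Rightarrow> real" where "d abs_summable_on UNIV"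
    "\<And>z. (\<Sum>\<^sub>\<infinity>s. of_real (d s) * dual.chr (- s) z) = inverse (symbol z)"
proof
  have "\<alpha> abs_summable_on UNIV"
    using has_sum_imp_summable[OF \<alpha>[of 0]] by (simp add: summable_on_iff_abs_summable_on_complex)
  then show "(\<lambda>s. Re (\<alpha> s)) abs_summable_on UNIV"
    by (rule summable_on_comparison_test) (auto intro: abs_Re_le_cmod)
  fix z
  have "((\<lambda>s. cnj (\<alpha> s * dual.chr (- s) (- z))) has_sum cnj (inverse (symbol (- z)))) UNIV"
    using \<alpha>[of "- z"] by (simp only: has_sum_cnj_iff)
  then have "((\<lambda>s. cnj (\<alpha> s) * dual.chr (- s) z) has_sum inverse (symbol z)) UNIV"
    by (simp add: symbol_uminus dual.chr_uminus_right)
  from has_sum_add[OF \<alpha>[of z] this]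
  have "((\<lambda>s. 2 * (of_real (Re (\<alpha> s)) * dual.chr (- s) z)) has_sum 2 * inverse (symbol z)) UNIV"
    by (simp add: complex_add_cnj flip: distrib_right mult.assoc) 
  then have "((\<lambda>s. of_real (Re (\<alpha> s)) * dual.chr (- s) z) has_sum inverse (symbol z)) UNIV"
    by (subst (asm) has_sum_cmult_right_iff) auto
  then show "(\<Sum>\<^sub>\<infinity>s. of_real (Re (\<alpha> s)) * dual.chr (- s) z) = inverse (symbol z)"
    by (rule infsumI)
qed

text \<open>
  Partial sums over large finite sets are \<open>L2\<close>-close to \<open>f\<close>. Adding one more index \<open>m\<close> changes such a
  partial sum by the single term \<open>c m * K(x - A m)\<close>, whose \<open>L2\<close> norm is \<open>|c m|\<close> times that of \<open>K\<close>.
  The only exceptions are the finitely many indices in the initial set \<open>M0\<close>.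
\<close>

lemma spline_coeffs_bounded:
  assumes f: "square_integrable f" and K2: "integrable lborel (\<lambda>x. (K x)\<^sup>2)" and x0: "K x0 \<noteq> 0"
    and lim: "((\<lambda>M. \<integral>\<^sup>+x. ennreal ((f x - (\<Sum>m\<in>M. c m * K (x - node A m)))\<^sup>2) \<partial>lborel)
           \<longlongrightarrow> 0) (finite_subsets_at_top UNIV)"
  obtains b where "\<And>m. \<bar>c m\<bar> \<le> b"
proof -
  define S where "S M x = (\<Sum>m\<in>M. c m * K (x - node A m))" for M x
  define I where "I M = (\<integral>\<^sup>+x. ennreal ((f x - S M x)\<^sup>2) \<partial>lborel)" for M
  have [measurable]: "f \<in> borel_measurable borel" using f by (simp add: square_integrable_def)
  have [measurable]: "S M \<in> borel_measurable borel" for M unfolding S_def by measurable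
  have "(I \<longlongrightarrow> 0) (finite_subsets_at_top UNIV)" using lim unfolding I_def S_def .
  then have "\<forall>\<^sub>F M in finite_subsets_at_top UNIV. I M < 1"
    by (rule order_tendstoD) simp
  then obtain M0 where M0: "finite M0" "\<And>M. finite M \<Longrightarrow> M0 \<subseteq> M \<Longrightarrow> I M < 1"
    by (auto simp: eventually_finite_subsets_at_top)
  define \<kappa> where "\<kappa> = (LINT x|lborel. (K x)\<^sup>2)"
  have \<kappa>: "\<kappa> > 0"
  proof -
    have "\<kappa> \<noteq> 0"
    proof
      assume "\<kappa> = 0"
      then have "AE x in lborel. (K x)\<^sup>2 = 0"
        unfolding \<kappa>_def using K2 by (subst (asm) integral_nonneg_eq_0_iff_AE) auto
      then have "AE x in lborel. x \<in> {x. K x = 0}" by simp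
      moreover have "closed {x. K x = 0}"
        using cont by (intro closed_Collect_eq continuous_intros)
      ultimately have "x0 \<in> {x. K x = 0}"
        using mem_closed_if_AE_lebesgue[of "{x. K x = 0}" x0] by (simp add: AE_completion)
      with x0 show False by simp
    qed
    moreover have "\<kappa> \<ge> 0" unfolding \<kappa>_def by simp
    ultimately show ?thesis by simp
  qed
  have out: "(c m)\<^sup>2 * \<kappa> \<le> 4" if m: "m \<notin> M0" for m
  proof -
    have sq: "(c m * K (x - node A m))\<^sup>2 \<le> 2 * (f x - S M0 x)\<^sup>2 + 2 * (f x - S (insert m M0) x)\<^sup>2" for x
    proof -
      have "S (insert m M0) x = c m * K (x - node A m) + S M0 x"
        unfolding S_def using M0(1) m by (rule sum.insert)
      then have eq: "c m * K (x - node A m) = (f x - S M0 x) - (f x - S (insert m M0) x)" by simp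
      have "(u - v)\<^sup>2 \<le> 2 * u\<^sup>2 + 2 * v\<^sup>2" for u v :: real
        using zero_le_power2[of "u + v"] by (simp add: power2_eq_square algebra_simps)
      then show ?thesis unfolding eq .
    qed
    have "ennreal ((c m)\<^sup>2 * \<kappa>) = (\<integral>\<^sup>+x. ennreal ((c m * K (x - node A m))\<^sup>2) \<partial>lborel)"
    proof -
      have "integrable lborel (\<lambda>x. (K (x + - node A m))\<^sup>2)"
        using integral_translate(2)[of "\<lambda>x. (K x)\<^sup>2" "- node A m"] K2 by simp
      then have "integrable lborel (\<lambda>x. (c m * K (x - node A m))\<^sup>2)"
        by (simp add: power_mult_distrib)
      then have "(\<integral>\<^sup>+x. ennreal ((c m * K (x - node A m))\<^sup>2) \<partial>lborel)
          = ennreal (LINT x|lborel. (c m * K (x - node A m))\<^sup>2)"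
        by (rule nn_integral_eq_integral) simp
      also have "(LINT x|lborel. (c m * K (x - node A m))\<^sup>2) = (c m)\<^sup>2 * \<kappa>"
        using integral_translate(1)[of "\<lambda>x. (K x)\<^sup>2" "- node A m"]
        by (simp add: power_mult_distrib \<kappa>_def)
      finally show ?thesis ..
    qed
    also have "\<dots> \<le> (\<integral>\<^sup>+x. 2 * ennreal ((f x - S M0 x)\<^sup>2) + 2 * ennreal ((f x - S (insert m M0) x)\<^sup>2) \<partial>lborel)"
    proof (rule nn_integral_mono)
      fix x
      have "ennreal ((c m * K (x - node A m))\<^sup>2) \<le> ennreal (2 * (f x - S M0 x)\<^sup>2 + 2 * (f x - S (insert m M0) x)\<^sup>2)"
        by (rule ennreal_leI[OF sq])
      also have "\<dots> = 2 * ennreal ((f x - S M0 x)\<^sup>2) + 2 * ennreal ((f x - S (insert m M0) x)\<^sup>2)"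
        by (simp add: ennreal_mult)
      finally show "ennreal ((c m * K (x - node A m))\<^sup>2)
          \<le> 2 * ennreal ((f x - S M0 x)\<^sup>2) + 2 * ennreal ((f x - S (insert m M0) x)\<^sup>2)" .
    qed
    also have "\<dots> = 2 * I M0 + 2 * I (insert m M0)"
      unfolding I_def by (subst nn_integral_add) (auto simp: nn_integral_cmult)
    also have "\<dots> \<le> 2 * 1 + 2 * 1"
      using M0 by (intro add_mono mult_left_mono less_imp_le) auto
    also have "\<dots> = ennreal 4" by simp
    finally show ?thesis by (subst (asm) ennreal_le_iff) auto
  qed
  have "\<bar>c m\<bar> \<le> sqrt (4 / \<kappa>) + (\<Sum>m\<in>M0. \<bar>c m\<bar>)" for m
  proof (cases "m \<in> M0")
    case True
    have "\<bar>c m\<bar> \<le> (\<Sum>m\<in>M0. \<bar>c m\<bar>)"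
      using M0(1) True by (intro member_le_sum) auto
    then show ?thesis using \<kappa> by (simp add: add_increasing)
  next
    case False
    have "(c m)\<^sup>2 \<le> 4 / \<kappa>" using out[OF False] \<kappa> by (simp add: field_simps)
    then have "\<bar>c m\<bar> \<le> sqrt (4 / \<kappa>)" by (metis real_sqrt_abs real_sqrt_le_iff)
    then show ?thesis by (simp add: add_increasing2 sum_nonneg)
  qed
  then show thesis by (rule that)
qed

end

locale invertible_symbol = decaying_kernel A B K C \<delta>
  for A B :: "real ^ 'n ^ 'n" and K C \<delta> +
  fixes d :: "int ^ 'n \<Rightarrow> real"
  assumes d_summable: "d abs_summable_on UNIV"
    and symbol_nonzero: "\<And>z. symbol z \<noteq> 0"
    and d_inverse: "\<And>z. (\<Sum>\<^sub>\<infinity>s. of_real (d s) * dual.chr (- s) z) = inverse (symbol z)"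
begin

definition cardinal_spline :: "real ^ 'n \<Rightarrow> real" where
  "cardinal_spline x = (\<Sum>\<^sub>\<infinity>m. d m * K (x - node A m))"

text \<open>
  The Fourier series of the convolution of \<open>d\<close> with the samples is the product of the two series,
  hence constantly \<open>1\<close>. Its coefficients are recovered by integration against the characters.
\<close>

lemma d_convolution: "(\<Sum>\<^sub>\<infinity>s. d s * k (t - s)) = (if t = 0 then 1 else 0)"
proof -
  define b where "b t = (\<Sum>\<^sub>\<infinity>s. d s * k (t - s))" for t
  have pairs: "(\<lambda>(s, t). d s * k (t - s)) abs_summable_on UNIV \<times> UNIV"
    by (rule abs_summable_on_convolution[OF d_summable k_summable])
  have pairs': "(\<lambda>(t, s). d s * k (t - s)) abs_summable_on UNIV \<times> UNIV"
    using pairs by (subst summable_on_reindex_bij_betw[of prod.swap "UNIV \<times> UNIV" "UNIV \<times> UNIV", symmetric])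
      (auto simp: case_prod_unfold)
  have norms: "(\<lambda>t. \<Sum>\<^sub>\<infinity>s. norm (d s * k (t - s))) summable_on UNIV"
    and rows: "(\<lambda>s. d s * k (t - s)) abs_summable_on UNIV" for t
    using pairs' unfolding Infinite_Sum.abs_summable_on_Sigma_iff
    by (simp_all add: abs_of_nonneg infsum_nonneg)
  have b_sum: "b abs_summable_on UNIV"
    by (rule summable_on_comparison_test[OF norms])
      (use norm_infsum_bound[OF rows] in \<open>auto simp: b_def\<close>)
  have one: "(\<Sum>\<^sub>\<infinity>t. of_real (b t) * dual.chr (- t) z) = 1" for z
  proof -
    define H where "H s t = complex_of_real (d s * k (t - s)) * dual.chr (- t) z" for s t
    have chr_split: "H s t = (of_real (d s) * dual.chr (- s) z) * (of_real (k (t - s)) * dual.chr (- (t - s)) z)" for s t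
    proof -
      have "dual.chr (- t) z = dual.chr (- s) z * dual.chr (- (t - s)) z"
        by (simp flip: dual.chr_add)
      then show ?thesis by (simp add: H_def)
    qed
    have "(\<lambda>(s, t). H s t) abs_summable_on UNIV \<times> UNIV"
      using pairs by (simp add: H_def norm_mult abs_mult case_prod_unfold)
    then have sm: "(\<lambda>(s, t). H s t) summable_on UNIV \<times> UNIV"
      by (rule abs_summable_summable)
    have "(\<Sum>\<^sub>\<infinity>t. of_real (b t) * dual.chr (- t) z) = (\<Sum>\<^sub>\<infinity>t. \<Sum>\<^sub>\<infinity>s. H s t)"
      unfolding b_def H_def infsum_cmult_left'
      by (simp only: infsum_complex_of_real[OF abs_summable_summable[OF rows]])
    also have "\<dots> = (\<Sum>\<^sub>\<infinity>s. \<Sum>\<^sub>\<infinity>t. H s t)"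
      by (rule infsum_swap_banach[OF sm, symmetric])
    also have "\<dots> = (\<Sum>\<^sub>\<infinity>s. of_real (d s) * dual.chr (- s) z * symbol z)"
    proof (rule infsum_cong)
      fix s
      have "(\<Sum>\<^sub>\<infinity>t. of_real (k (t - s)) * dual.chr (- (t - s)) z) = symbol z"
        unfolding symbol_def by (rule infsum_reindex_bij_betw[OF bij_shift])
      then show "(\<Sum>\<^sub>\<infinity>t. H s t) = of_real (d s) * dual.chr (- s) z * symbol z"
        unfolding chr_split by (simp add: infsum_cmult_right')
    qed
    also have "\<dots> = 1"
      by (simp add: infsum_cmult_left' d_inverse symbol_nonzero)
    finally show ?thesis .
  qed
  define b' where "b' m = complex_of_real (b (- m))" for m
  have b': "(\<lambda>m. norm (b' m)) summable_on UNIV"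
    using b_sum summable_on_reindex_bij_betw[OF bij_reflect[of 0], of "\<lambda>m. norm (b m)"]
    by (simp add: b'_def)
  have "(\<Sum>\<^sub>\<infinity>m. b' m * dual.chr m z) = 1" for z
    using one[of z] infsum_reindex_bij_betw[OF bij_reflect[of 0], of "\<lambda>t. of_real (b t) * dual.chr (- t) z"]
    by (simp add: b'_def)
  then have "b' (- t) * of_real dual.vol = (LINT z|dual.\<mu>. dual.chr t z)"
    using dual.integral_chr_series[OF b', of "- t"] by simp
  then have "complex_of_real (b t) = (if t = 0 then 1 else 0)"
    using dual.vol_pos by (simp add: b'_def dual.integral_chr split: if_splits)
  then show ?thesis unfolding b_def by (simp add: complex_eq_iff split: if_splits)
qed

lemma cardinal_series_summable: "(\<lambda>m. d m * K (x - node A m)) abs_summable_on UNIV"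
  by (rule summable_on_comparison_test[OF summable_on_cmult_left[OF d_summable, of C]])
    (auto simp: abs_mult intro!: mult_left_mono K_bounded)

lemma cardinal_spline_node: "cardinal_spline (node A t) = (if t = 0 then 1 else 0)"
  using d_convolution[of t] by (simp add: cardinal_spline_def k_def)

lemma integrable_K_translate: "integrable lborel (\<lambda>x. K (x - v))"
  using integral_translate(2)[OF K_meas, of "- v"] integrable_K by simp

lemma integrable_majorant: "integrable lborel (\<lambda>x. \<Sum>\<^sub>\<infinity>m. \<bar>d m * K (x - node A m)\<bar>)"
  and integrable_cardinal_spline: "integrable lborel cardinal_spline"
proof -
  have "(LINT x|lborel. \<bar>d m * K (x - node A m)\<bar>) = \<bar>d m\<bar> * (LINT x|lborel. \<bar>K x\<bar>)" for m
    using integral_translate(1)[of "\<lambda>x. \<bar>K x\<bar>" "- node A m"] by (simp add: abs_mult)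
  then have sm: "(\<lambda>m. LINT x|lborel. \<bar>d m * K (x - node A m)\<bar>) summable_on UNIV"
    using d_summable by (simp add: summable_on_cmult_left)
  show "integrable lborel (\<lambda>x. \<Sum>\<^sub>\<infinity>m. \<bar>d m * K (x - node A m)\<bar>)"
    by (rule has_sum_integral(1)[OF infinite_int_vec])
      (use sm cardinal_series_summable in \<open>auto intro!: integrable_abs integrable_mult_right integrable_K_translate\<close>)
  show "integrable lborel cardinal_spline"
    unfolding cardinal_spline_def
    by (rule has_sum_integral(1)[OF infinite_int_vec])
      (use sm cardinal_series_summable in \<open>auto intro!: integrable_mult_right integrable_K_translate\<close>)
qed

text \<open>
  The square of the tail is at most the product of its supremum norm, which is bounded by
  \<open>C\<close> times the tail of \<open>\<Sum>m. |d m|\<close>, and its absolute value, which is dominated by one integrable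
  function for all finite sets \<open>M\<close>.
\<close>

lemma cardinal_spline_tail_nn_integral:
  assumes "finite M"
  shows "(\<integral>\<^sup>+x. ennreal ((cardinal_spline x - (\<Sum>m\<in>M. d m * K (x - node A m)))\<^sup>2) \<partial>lborel)
    \<le> ennreal (C * ((\<Sum>\<^sub>\<infinity>m. \<bar>d m\<bar>) - (\<Sum>m\<in>M. \<bar>d m\<bar>)) * (LINT x|lborel. (\<Sum>\<^sub>\<infinity>m. \<bar>d m * K (x - node A m)\<bar>)))"
proof -
  define r where "r = (\<Sum>\<^sub>\<infinity>m. \<bar>d m\<bar>) - (\<Sum>m\<in>M. \<bar>d m\<bar>)"
  have d_abs: "(\<lambda>m. \<bar>d m\<bar>) summable_on S" for S
    using d_summable by (auto intro: summable_on_subset_banach)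
  have r_eq: "r = (\<Sum>\<^sub>\<infinity>m\<in>- M. \<bar>d m\<bar>)"
    using infsum_Diff[of "\<lambda>m. \<bar>d m\<bar>" UNIV M] d_abs assms by (simp add: r_def Compl_eq_Diff_UNIV)
  have pw: "(cardinal_spline x - (\<Sum>m\<in>M. d m * K (x - node A m)))\<^sup>2
      \<le> C * r * (\<Sum>\<^sub>\<infinity>m. \<bar>d m * K (x - node A m)\<bar>)" for x
  proof -
    let ?f = "\<lambda>m. d m * K (x - node A m)"
    have abs_sm: "(\<lambda>m. \<bar>?f m\<bar>) summable_on S" for S
      using cardinal_series_summable[of x] by (auto intro: summable_on_subset_banach)
    have sm: "?f summable_on S" for S
      by (rule abs_summable_summable) (use abs_sm in simp)
    have "cardinal_spline x - (\<Sum>m\<in>M. ?f m) = (\<Sum>\<^sub>\<infinity>m\<in>- M. ?f m)"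
      using infsum_Diff[of ?f UNIV M] sm assms by (simp add: cardinal_spline_def Compl_eq_Diff_UNIV)
    then have 1: "\<bar>cardinal_spline x - (\<Sum>m\<in>M. ?f m)\<bar> \<le> (\<Sum>\<^sub>\<infinity>m\<in>- M. \<bar>?f m\<bar>)"
      using norm_infsum_bound[of ?f "- M"] abs_sm by simp
    have 2: "(\<Sum>\<^sub>\<infinity>m\<in>- M. \<bar>?f m\<bar>) \<le> (\<Sum>\<^sub>\<infinity>m. \<bar>?f m\<bar>)"
      by (rule infsum_mono2) (use abs_sm in auto)
    have "(\<Sum>\<^sub>\<infinity>m\<in>- M. \<bar>?f m\<bar>) \<le> (\<Sum>\<^sub>\<infinity>m\<in>- M. C * \<bar>d m\<bar>)"
      by (rule infsum_mono)
        (use abs_sm in \<open>auto simp: abs_mult mult.commute[of C] intro!: mult_left_mono K_bounded summable_on_cmult_left d_abs\<close>)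
    then have 3: "(\<Sum>\<^sub>\<infinity>m\<in>- M. \<bar>?f m\<bar>) \<le> C * r" by (simp add: r_eq infsum_cmult_right')
    have "\<bar>cardinal_spline x - (\<Sum>m\<in>M. ?f m)\<bar> * \<bar>cardinal_spline x - (\<Sum>m\<in>M. ?f m)\<bar>
        \<le> (C * r) * (\<Sum>\<^sub>\<infinity>m. \<bar>?f m\<bar>)"
      using 1 2 3 by (intro mult_mono) (auto intro: order_trans infsum_nonneg)
    then show ?thesis by (simp add: power2_eq_square)
  qed
  have r0: "r \<ge> 0" unfolding r_eq by (rule infsum_nonneg) simp
  have "(\<integral>\<^sup>+x. ennreal ((cardinal_spline x - (\<Sum>m\<in>M. d m * K (x - node A m)))\<^sup>2) \<partial>lborel)
      \<le> (\<integral>\<^sup>+x. ennreal (C * r * (\<Sum>\<^sub>\<infinity>m. \<bar>d m * K (x - node A m)\<bar>)) \<partial>lborel)"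
    by (intro nn_integral_mono ennreal_leI pw)
  also have "\<dots> = ennreal (LINT x|lborel. (C * r * (\<Sum>\<^sub>\<infinity>m. \<bar>d m * K (x - node A m)\<bar>)))"
    by (rule nn_integral_eq_integral)
      (use r0 C_nonneg in \<open>auto intro!: integrable_mult_right integrable_majorant mult_nonneg_nonneg infsum_nonneg\<close>)
  also have "\<dots> = ennreal (C * r * (LINT x|lborel. (\<Sum>\<^sub>\<infinity>m. \<bar>d m * K (x - node A m)\<bar>)))" by simp
  finally show ?thesis unfolding r_def .
qed

lemma cardinal_spline_fundamental: "fundamental_spline K A cardinal_spline"
proof -
  let ?J = "LINT x|lborel. (\<Sum>\<^sub>\<infinity>m. \<bar>d m * K (x - node A m)\<bar>)"
  have meas: "cardinal_spline \<in> borel_measurable lborel"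
    using integrable_cardinal_spline by (rule borel_measurable_integrable)
  have "(\<integral>\<^sup>+x. ennreal ((cardinal_spline x)\<^sup>2) \<partial>lborel) < \<infinity>"
    using cardinal_spline_tail_nn_integral[of "{}"] by (simp add: le_less_trans[OF _ ennreal_less_top])
  then have sq: "square_integrable cardinal_spline"
    unfolding square_integrable_def using meas by (auto intro!: integrableI_nonneg)
  have ptw: "((\<lambda>m. d m * K (x - node A m)) has_sum cardinal_spline x) UNIV" for x
    unfolding cardinal_spline_def
    using abs_summable_summable[OF cardinal_series_summable] by (rule has_sum_infsum)
  have "((\<lambda>m. \<bar>d m\<bar>) has_sum (\<Sum>\<^sub>\<infinity>m. \<bar>d m\<bar>)) UNIV"
    using d_summable by (intro has_sum_infsum) simp
  then have "((\<lambda>M. \<Sum>m\<in>M. \<bar>d m\<bar>) \<longlongrightarrow> (\<Sum>\<^sub>\<infinity>m. \<bar>d m\<bar>)) (finite_subsets_at_top UNIV)"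
    by (simp add: has_sum_def)
  then have "((\<lambda>M. C * ((\<Sum>\<^sub>\<infinity>m. \<bar>d m\<bar>) - (\<Sum>m\<in>M. \<bar>d m\<bar>)) * ?J)
      \<longlongrightarrow> C * ((\<Sum>\<^sub>\<infinity>m. \<bar>d m\<bar>) - (\<Sum>\<^sub>\<infinity>m. \<bar>d m\<bar>)) * ?J) (finite_subsets_at_top UNIV)"
    by (intro tendsto_intros)
  then have "((\<lambda>M. ennreal (C * ((\<Sum>\<^sub>\<infinity>m. \<bar>d m\<bar>) - (\<Sum>m\<in>M. \<bar>d m\<bar>)) * ?J)) \<longlongrightarrow> 0)
      (finite_subsets_at_top UNIV)"
    using tendsto_ennrealI by fastforce
  then have "((\<lambda>M. \<integral>\<^sup>+x. ennreal ((cardinal_spline x - (\<Sum>m\<in>M. d m * K (x - node A m)))\<^sup>2) \<partial>lborel)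
      \<longlongrightarrow> 0) (finite_subsets_at_top UNIV)"
    by (rule tendsto_sandwich[OF _ _ tendsto_const, rotated 2])
      (auto intro!: eventually_finite_subsets_at_top_weakI cardinal_spline_tail_nn_integral)
  then show ?thesis
    unfolding fundamental_spline_def SK_def using sq ptw cardinal_spline_node by blast
qed

lemma exists_K_nonzero: "\<exists>x. K x \<noteq> 0"
proof (rule ccontr)
  assume "\<nexists>x. K x \<noteq> 0"
  then have "symbol 0 = 0" by (simp add: symbol_def k_def)
  with symbol_nonzero show False by blast
qed

lemma fundamental_spline_unique:
  assumes f: "fundamental_spline K A f"
  shows "f = cardinal_spline"
proof -
  obtain c where sq: "square_integrable f"
    and c: "\<And>x. ((\<lambda>m. c m * K (x - node A m)) has_sum f x) UNIV"
    and lim: "((\<lambda>M. \<integral>\<^sup>+x. ennreal ((f x - (\<Sum>m\<in>M. c m * K (x - node A m)))\<^sup>2) \<partial>lborel)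
           \<longlongrightarrow> 0) (finite_subsets_at_top UNIV)"
    using f unfolding fundamental_spline_def SK_def by blast
  have K2: "integrable lborel (\<lambda>x. (K x)\<^sup>2)"
  proof (rule Bochner_Integration.integrable_bound)
    show "integrable lborel (\<lambda>x. C * K x)" using integrable_K by simp
    show "AE x in lborel. norm ((K x)\<^sup>2) \<le> norm (C * K x)"
    proof (rule AE_I2)
      fix x
      have "\<bar>K x\<bar> * \<bar>K x\<bar> \<le> C * \<bar>K x\<bar>" by (intro mult_right_mono K_bounded) simp
      then show "norm ((K x)\<^sup>2) \<le> norm (C * K x)" using C_nonneg by (simp add: abs_mult power2_eq_square)
    qed
  qed measurable
  obtain x0 where x0: "K x0 \<noteq> 0" using exists_K_nonzero by blast
  obtain b where b: "\<And>m. \<bar>c m\<bar> \<le> b" using spline_coeffs_bounded[OF sq K2 x0 lim] by blast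
  have ck: "(\<Sum>\<^sub>\<infinity>s. c s * k (t - s)) = (if t = 0 then 1 else 0)" for t
    using infsumI[OF c[of "node A t"]] f by (simp add: fundamental_spline_def k_def)
  have "c = d"
    by (rule convolution_inverse_unique[OF k_summable d_summable _ d_convolution ck]) (rule b)
  then show ?thesis
    using infsumI[OF c] by (auto simp: cardinal_spline_def)
qed

text \<open>
  The factor \<open>exp(-i \<langle>A s, y\<rangle>)\<close> in the series of the inverse symbol translates the inverse
  Fourier transform of \<open>FK\<close>, that is \<open>K\<close>, by \<open>A s\<close>.
\<close>

lemma cardinal_spline_fourier_inv:
  "complex_of_real (cardinal_spline x) = fourier_inv (\<lambda>y. FK y / symbol y) x"
proof -
  define g where "g s y = cis (x \<bullet> y) * FK y * (of_real (d s) * dual.chr (- s) y)" for s y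
  have [measurable]: "(\<lambda>y. cis (x \<bullet> y)) \<in> borel_measurable borel"
    by (intro borel_measurable_continuous_onI continuous_intros)
  have g_norm: "norm (g s y) = norm (FK y) * \<bar>d s\<bar>" for s y by (simp add: g_def norm_mult)
  have g_int: "integrable lborel (g s)" for s
    by (rule Bochner_Integration.integrable_bound[of _ "\<lambda>y. norm (FK y) * \<bar>d s\<bar>"])
      (use integrable_FK in \<open>auto simp: g_norm\<close>, unfold g_def, measurable)
  have "((\<lambda>s. LINT y|lborel. g s y) has_sum (LINT y|lborel. (\<Sum>\<^sub>\<infinity>s. g s y))) UNIV"
    by (rule has_sum_integral(2)[OF infinite_int_vec g_int])
      (use d_summable in \<open>auto simp: g_norm intro!: summable_on_cmult_right\<close>)
  moreover have "(\<Sum>\<^sub>\<infinity>s. g s y) = cis (x \<bullet> y) * (FK y / symbol y)" for y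
    unfolding g_def infsum_cmult_right' d_inverse by (simp add: divide_inverse)
  moreover have "(LINT y|lborel. g s y) = (2 * of_real pi) ^ CARD('n) * of_real (d s * K (x - node A s))" for s
  proof -
    have "g s y = of_real (d s) * (cis ((x - node A s) \<bullet> y) * FK y)" for y
    proof -
      have "cis (x \<bullet> y) * dual.chr (- s) y = cis ((x - node A s) \<bullet> y)"
        by (simp add: dual_chr_eq cis_mult inner_diff_left)
      then show ?thesis by (simp add: g_def algebra_simps)
    qed
    then have "(LINT y|lborel. g s y) = of_real (d s) * (LINT y|lborel. cis ((x - node A s) \<bullet> y) * FK y)"
      by simp
    also have "(LINT y|lborel. cis ((x - node A s) \<bullet> y) * FK y)
        = (2 * of_real pi) ^ CARD('n) * fourier_inv FK (x - node A s)"
      by (simp add: fourier_inv_def cis_conv_exp)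
    finally show ?thesis
      by (simp add: fourier_inversion[OF \<delta> cont K_decay FK_decay])
  qed
  ultimately have "((\<lambda>s. (2 * of_real pi) ^ CARD('n) * complex_of_real (d s * K (x - node A s)))
      has_sum (LINT y|lborel. cis (x \<bullet> y) * (FK y / symbol y))) UNIV"
    by simp
  then have "(\<Sum>\<^sub>\<infinity>s. (2 * of_real pi) ^ CARD('n) * complex_of_real (d s * K (x - node A s)))
      = (LINT y|lborel. cis (x \<bullet> y) * (FK y / symbol y))"
    by (rule infsumI)
  then have "(2 * of_real pi) ^ CARD('n) * complex_of_real (cardinal_spline x)
      = (LINT y|lborel. cis (x \<bullet> y) * (FK y / symbol y))"
    by (simp only: infsum_cmult_right' infsum_complex_of_real[OF abs_summable_summable[OF cardinal_series_summable]]
        cardinal_spline_def)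
  then show ?thesis by (simp add: fourier_inv_def cis_conv_exp field_simps)
qed

end

theorem corollary1:
  fixes A :: "real ^ 'n ^ 'n" and K :: "real ^ 'n \<Rightarrow> real"
  assumes "invertible A"
    and "square_integrable K" and "integrable lborel K" and "continuous_on UNIV K"
    and "\<exists>C>0. \<exists>\<delta>>0. \<forall>x.
           max \<bar>K x\<bar> (cmod (fourier (\<lambda>t. complex_of_real (K t)) x))
             \<le> C * (1 + norm x) powr (- real CARD('n) - \<delta>)"
    and "\<forall>z \<in> (\<lambda>x. (2 * pi) *\<^sub>R (transpose (matrix_inv A) *v x)) ` {x. \<forall>k. 0 \<le> x $ k \<and> x $ k \<le> 1}.
           periodization K A z \<noteq> 0"
    and "\<exists>\<alpha> :: int ^ 'n \<Rightarrow> complex. \<forall>z.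
           ((\<lambda>s. \<alpha> s * exp (- \<i> * complex_of_real (node A s \<bullet> z)))
              has_sum inverse (periodization K A z)) UNIV"
  shows "(\<exists>!sk. fundamental_spline K A sk) \<and>
         (\<forall>sk. fundamental_spline K A sk \<longrightarrow>
            (\<forall>x. complex_of_real (sk x) =
               fourier_inv
                 (\<lambda>y. fourier (\<lambda>t. complex_of_real (K t)) y /
                    (\<Sum>\<^sub>\<infinity>m\<in>UNIV. complex_of_real (K (- node A m)) *
                       exp (\<i> * complex_of_real (node A m \<bullet> y)))) x))"
proof -
  obtain C \<delta> where "\<delta> > 0"
    and decay: "\<And>x. max \<bar>K x\<bar> (cmod (fourier (\<lambda>t. complex_of_real (K t)) x)) \<le> C * decay \<delta> x"
    using assms(5) unfolding decay_def by blast
  interpret decaying_kernel A "matrix_inv A" K C \<delta>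
  proof
    show "A ** matrix_inv A = mat 1" 
      using assms(1) someI_ex[of "\<lambda>B. A ** B = mat 1 \<and> B ** A = mat 1"]
      unfolding invertible_def matrix_inv_def by blast
    show "\<bar>K x\<bar> \<le> C * decay \<delta> x" for x using decay[of x] by simp
    show "norm (fourier (\<lambda>t. complex_of_real (K t)) x) \<le> C * decay \<delta> x" for x using decay[of x] by simp
  qed fact+
  have per: "periodization K A z = of_real vol * symbol z" for z
    unfolding vol_symbol periodization_def dnode_eq ..
  have nonzero: "symbol z \<noteq> 0" for z
  proof -
    \<comment> \<open>The hypothesis speaks of one closed cell only; the symbol is periodic for the dual lattice, so
      \<open>z\<close> is reduced to that cell by the integer parts of its dual coordinates.\<close>
    let ?u = "((1 / (2 * pi)) *\<^sub>R transpose A) *v z"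
    define m :: "int ^ 'n" where "m = (\<chi> k. \<lfloor>?u $ k\<rfloor>)"
    define q where "q = ?u - real_vec m"
    have q: "0 \<le> q $ k \<and> q $ k \<le> 1" for k
      unfolding q_def m_def real_vec_def by (simp, linarith)
    define w where "w = (2 * pi) *\<^sub>R (transpose (matrix_inv A) *v q)"
    have "w = ((2 * pi) *\<^sub>R transpose (matrix_inv A)) *v ?u - dnode m"
      unfolding w_def q_def scaleR_matrix_vector_assoc
      by (simp only: scaleR_matrix_vector_assoc node_def matrix_vector_mult_diff_distrib)
    then have z: "z = w + dnode m" unfolding dual.A_B_cancel by simp
    have "periodization K A w \<noteq> 0" using assms(6) q unfolding w_def by blast
    then have "symbol w \<noteq> 0" by (simp add: per)
    then show ?thesis by (simp add: z symbol_def)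
  qed
  obtain \<alpha> where \<alpha>: "\<And>z. ((\<lambda>s. \<alpha> s * exp (- \<i> * complex_of_real (node A s \<bullet> z)))
              has_sum inverse (periodization K A z)) UNIV"
    using assms(7) by blast
  have coeffs: "((\<lambda>s. (of_real vol * \<alpha> s) * dual.chr (- s) z) has_sum inverse (symbol z)) UNIV" for z
  proof -
    have "exp (- \<i> * complex_of_real (node A s \<bullet> z)) = dual.chr (- s) z" for s
      by (simp add: dual_chr_eq cis_conv_exp)
    then have "((\<lambda>s. of_real vol * (\<alpha> s * dual.chr (- s) z)) has_sum
        of_real vol * inverse (periodization K A z)) UNIV"
      using \<alpha>[of z] by (intro has_sum_cmult_right) simp
    moreover have "of_real vol * inverse (periodization K A z) = inverse (symbol z)"
      using vol_pos by (simp add: per field_simps)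
    ultimately show ?thesis by (simp only: mult.assoc)
  qed
  obtain d where "d abs_summable_on UNIV"
    "\<And>z. (\<Sum>\<^sub>\<infinity>s. of_real (d s) * dual.chr (- s) z) = inverse (symbol z)"
    using real_inverse_coefficients[OF coeffs] by blast
  then interpret invertible_symbol A "matrix_inv A" K C \<delta> d
    using nonzero by unfold_locales auto
  have denominator: "(\<Sum>\<^sub>\<infinity>m. complex_of_real (K (- node A m)) * exp (\<i> * complex_of_real (node A m \<bullet> y)))
      = symbol y" for y
    unfolding symbol_def
    by (rule infsum_reindex_bij_witness[of _ uminus uminus])
      (auto simp: k_def dual_chr_eq cis_conv_exp)
  show ?thesis
  proof (intro conjI ex1I allI impI)
    show "fundamental_spline K A cardinal_spline" by (rule cardinal_spline_fundamental)
  next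
    fix sk assume "fundamental_spline K A sk"
    then show "sk = cardinal_spline" by (rule fundamental_spline_unique)
  next
    fix sk x assume "fundamental_spline K A sk"
    then have "sk = cardinal_spline" by (rule fundamental_spline_unique)
    then show "complex_of_real (sk x) = fourier_inv (\<lambda>y. FK y /
        (\<Sum>\<^sub>\<infinity>m. complex_of_real (K (- node A m)) * exp (\<i> * complex_of_real (node A m \<bullet> y)))) x"
      unfolding denominator by (simp only: cardinal_spline_fourier_inv)
  qed
qed

end
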